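(* Let $\mathcal{G}$ be a finite connected graph with vertex set $[n]=\{1,\dots,n\}$, edge weights $a$ and vertex potential $b$. Let $\mathcal{T}$ be its universal cover with the induced periodic edge weights and vertex potential, and let $A_{\mathcal{T}}$ be the corresponding Jacobi matrix on $\mathcal{T}$. If $\rho_r(A_{\mathcal{T}})$ denotes the right edge (i.e. the maximum element) of the spectrum of $A_{\mathcal{T}}$, then $$\rho_r(A_{\mathcal{T}}) = \inf_{y_1,\dots,y_n>0}\ \max_{i\in[n]}\left[ b_i+\frac{1}{2y_i}\left(2-\deg(i)+\sum_{f\in\sigma(i)}\left(1+4a_f^2\,y_{\sigma(f)}\,y_{\tau(f)}\right)^{1/2}\right)\right],$$ where $\deg(i)$ is the degree of the vertex $i$ in $\mathcal{G}$. Moreover, the infimum can be restricted to those $n$-tuples $(y_1,\dots,y_n)$ of positive reals for which the $n$ expressions inside the $\max$ are equal to each other (i.e. the infimum over such tuples has the same value).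
   Context: Graphs. A graph $\mathcal{G}$ is locally finite and undirected, with loops and multi-edges allowed. It has a vertex set $V(\mathcal{G})$ and a set $E(\mathcal{G})$ of directed edges; each $f\in E(\mathcal{G})$ has a source $\sigma(f)$ and a target $\tau(f)$ in $V(\mathcal{G})$, and there is an involution $f\mapsto\check f$ on $E(\mathcal{G})$ (edge reversal) with $\sigma(\check f)=\tau(f)$ and $\tau(\check f)=\sigma(f)$. Here $\check f\ne f$ for all $f$ (every loop is a "whole-loop", consisting of two distinct directed edges $f,\check f$ at the same vertex; "half-loops" $\check f=f$ are not allowed). For a vertex $u$, $\sigma(u)=\{f\in E(\mathcal{G}):\sigma(f)=u\}$. The degree $\deg(u)$ is $|\sigma(u)|$ (loops contribute twice). Edge weights are a function $a:E(\mathcal{G})\to\mathbb{R}$ with $a_f=a_{\check f}$; a vertex potential is a function $b:V(\mathcal{G})\to\mathbb{R}$. The Jacobi matrix $A_{\mathcal{G}}$ is the operator on $\ell^2(V(\mathcal{G}))$ given by $$(A_{\mathcal{G}}\xi)(u)=b_u\,\xi(u)+\sum_{f\in\sigma(u)}a_f\,\xi(\tau(f)).$$ Universal cover. Fix $v_0\in V(\mathcal{G})$, $\mathcal{G}$ finite and connected. A non-backtracking walk starting at $v_0$ is a finite (possibly empty) sequence $f_1,\dots,f_m$ of directed edges with $\sigma(f_1)=v_0$, $\tau(f_i)=\sigma(f_{i+1})$ and $f_{i+1}\neq\check f_i$. The universal cover $\mathcal{T}=\mathcal{T}(\mathcal{G})$ is the tree whose vertices are these walks, two walks being joined by an edge when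 one is obtained from the other by appending one edge at the end. The covering map $\Xi:\mathcal{T}\to\mathcal{G}$ sends a walk to its end vertex (the empty walk to $v_0$). The edge weights and potential are lifted to $\mathcal{T}$ through $\Xi$: the edge joining a walk $w$ to the walk $wf$ has weight $a_f$ and the vertex $w$ has potential $b_{\Xi(w)}$. $A_{\mathcal{T}}$ is the Jacobi matrix of $\mathcal{T}$ with these lifted coefficients; it is a bounded self-adjoint operator. *)

theory Defs
  imports
    "HOL-Analysis.Analysis"
    "Graph_Theory.Bidirected_Digraph"
    "Graph_Theory.Arc_Walk"
    "Graph_Theory.Digraph_Component"
begin

text \<open>
  Graphs with loops and multi-edges are multidigraphs together with an edge reversal, as in the
  locale \<^locale>\<open>bidirected_digraph\<close>. Its axioms say that \<open>arev e \<noteq> e\<close> for every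
  directed edge (no half-loops); the reversal is normalised to be the identity off the edge set.
  The degree of \<open>u\<close> is \<open>out_degree G u\<close>, and \<open>out_arcs G u\<close> is the set of edges with source \<open>u\<close>.
\<close>

definition ell2 :: "'v set \<Rightarrow> ('v \<Rightarrow> complex) set" where
  "ell2 V = {\<xi>. (\<forall>v. v \<notin> V \<longrightarrow> \<xi> v = 0) \<and> (\<lambda>v. (cmod (\<xi> v))\<^sup>2) summable_on V}"

definition ell2_norm :: "'v set \<Rightarrow> ('v \<Rightarrow> complex) \<Rightarrow> real" where
  "ell2_norm V \<xi> = sqrt (\<Sum>\<^sub>\<infinity>v\<in>V. (cmod (\<xi> v))\<^sup>2)"

definition bounded_operator :: "'v set \<Rightarrow> (('v \<Rightarrow> complex) \<Rightarrow> ('v \<Rightarrow> complex)) \<Rightarrow> bool" where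
  "bounded_operator V T \<longleftrightarrow>
     (\<forall>\<xi>\<in>ell2 V. T \<xi> \<in> ell2 V) \<and>
     (\<forall>\<xi>\<in>ell2 V. \<forall>\<eta>\<in>ell2 V. T (\<lambda>v. \<xi> v + \<eta> v) = (\<lambda>v. T \<xi> v + T \<eta> v)) \<and>
     (\<forall>c. \<forall>\<xi>\<in>ell2 V. T (\<lambda>v. c * \<xi> v) = (\<lambda>v. c * T \<xi> v)) \<and>
     (\<exists>C. \<forall>\<xi>\<in>ell2 V. ell2_norm V (T \<xi>) \<le> C * ell2_norm V \<xi>)"

definition spectrum :: "'v set \<Rightarrow> (('v \<Rightarrow> complex) \<Rightarrow> ('v \<Rightarrow> complex)) \<Rightarrow> complex set" where
  "spectrum V A = {z. \<not> (\<exists>R. bounded_operator V R \<and>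
     (\<forall>\<xi>\<in>ell2 V. R (\<lambda>v. A \<xi> v - z * \<xi> v) = \<xi>) \<and>
     (\<forall>\<xi>\<in>ell2 V. (\<lambda>v. A (R \<xi>) v - z * R \<xi> v) = \<xi>))}"

definition is_right_edge :: "complex set \<Rightarrow> real \<Rightarrow> bool" where
  "is_right_edge S r \<longleftrightarrow> complex_of_real r \<in> S \<and> (\<forall>z\<in>S. z \<in> \<real> \<and> Re z \<le> r)"

definition jacobi_matrix ::
  "('v, 'e) pre_digraph \<Rightarrow> ('e \<Rightarrow> real) \<Rightarrow> ('v \<Rightarrow> real) \<Rightarrow> ('v \<Rightarrow> complex) \<Rightarrow> ('v \<Rightarrow> complex)" where
  "jacobi_matrix G a b \<xi> u =
     (if u \<in> verts G
      then complex_of_real (b u) * \<xi> u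
        + (\<Sum>f\<in>out_arcs G u. complex_of_real (a f) * \<xi> (head G f))
      else 0)"

definition nb_walks :: "('v, 'e) pre_digraph \<Rightarrow> ('e \<Rightarrow> 'e) \<Rightarrow> 'v \<Rightarrow> 'e list set" where
  "nb_walks G arev v0 =
     {w. (\<exists>v. pre_digraph.awalk G v0 w v) \<and> successively (\<lambda>e f. f \<noteq> arev e) w}"

text \<open>
  The cover is a tree, in particular simple, so its directed edges are the ordered pairs of
  adjacent vertices.
\<close>

definition universal_cover ::
  "('v, 'e) pre_digraph \<Rightarrow> ('e \<Rightarrow> 'e) \<Rightarrow> 'v \<Rightarrow> ('e list, 'e list \<times> 'e list) pre_digraph" where
  "universal_cover G arev v0 =
     \<lparr> verts = nb_walks G arev v0,
       arcs = {(w, w'). w \<in> nb_walks G arev v0 \<and> w' \<in> nb_walks G arev v0 \<and>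
                 ((\<exists>f. w' = w @ [f]) \<or> (\<exists>f. w = w' @ [f]))},
       tail = fst,
       head = snd \<rparr>"

definition cover_map :: "('v, 'e) pre_digraph \<Rightarrow> 'v \<Rightarrow> 'e list \<Rightarrow> 'v" where
  "cover_map G v0 w = pre_digraph.awlast G v0 w"

text \<open>Both directions of the edge between \<open>w\<close> and \<open>w @ [f]\<close> get the weight of \<open>f\<close>.\<close>

definition lift_weight :: "('e \<Rightarrow> real) \<Rightarrow> 'e list \<times> 'e list \<Rightarrow> real" where
  "lift_weight a = (\<lambda>(w, w'). a (last (if length w < length w' then w' else w)))"

definition cover_jacobi_matrix ::
  "('v, 'e) pre_digraph \<Rightarrow> ('e \<Rightarrow> 'e) \<Rightarrow> 'v \<Rightarrow> ('e \<Rightarrow> real) \<Rightarrow> ('v \<Rightarrow> real)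
    \<Rightarrow> ('e list \<Rightarrow> complex) \<Rightarrow> ('e list \<Rightarrow> complex)" where
  "cover_jacobi_matrix G arev v0 a b =
     jacobi_matrix (universal_cover G arev v0) (lift_weight a) (\<lambda>w. b (cover_map G v0 w))"

definition edge_expr ::
  "('v, 'e) pre_digraph \<Rightarrow> ('e \<Rightarrow> real) \<Rightarrow> ('v \<Rightarrow> real) \<Rightarrow> ('v \<Rightarrow> real) \<Rightarrow> 'v \<Rightarrow> real" where
  "edge_expr G a b y i =
     b i + 1 / (2 * y i) *
       (2 - real (out_degree G i)
        + (\<Sum>f\<in>out_arcs G i. sqrt (1 + 4 * (a f)\<^sup>2 * y (tail G f) * y (head G f))))"

end

theory Submission
  imports Defs
begin

text \<open>
  For a bounded symmetric operator the right edge of the spectrum is the supremum of its quadratic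
  form on unit vectors (\<open>is_right_edge_top_form\<close>). This supremum for the Jacobi matrix of the tree,
  called \<open>top_form\<close>, has to be compared with tuples \<open>y\<close> on the finite graph.

  Every tuple gives an upper bound (\<open>top_form_le_edge_expr\<close>). For real \<open>p, q \<ge> 0\<close> with
  \<open>p q = a\<^sub>f\<^sup>2\<close>, the contribution \<open>2 a\<^sub>f Re (\<xi>(u) cnj \<xi>(v))\<close> of an edge to the form is at most
  \<open>p |\<xi>(u)|\<^sup>2 + q |\<xi>(v)|\<^sup>2\<close>. The tuple \<open>y\<close> determines \<open>p\<close> and \<open>q\<close> such that
  the potential and the shares that collect at a vertex of the tree over \<open>i\<close> add up to at most
  the expression of the theorem at \<open>i\<close>.

  Conversely, for each \<open>l\<close> above \<open>top_form\<close> there is a tuple whose expressions are all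
  equal to \<open>l\<close> (\<open>equalising_tuple_exists\<close>); letting \<open>l\<close> decrease to \<open>top_form\<close> settles both infima.
  The tuple is the diagonal of the resolvent of the tree at \<open>l\<close>, which depends only on the vertex
  of \<open>G\<close> below. It is not computed from the resolvent itself, because this would require the
  symmetries of the tree. Instead, the resolvent on the tree, which preserves positivity once the
  signs of the weights are gauged away, supplies a positive function \<open>\<phi>\<close> with \<open>|A| \<phi> \<le> l \<phi>\<close>
  (\<open>positive_supersolution\<close>). The infima over fibres of the ratios of \<open>\<phi>\<close> at neighbouring vertices
  give, for each arc \<open>f\<close> of \<open>G\<close>, a supersolution of the recursion that the Green functions of the
  branches of the tree satisfy (\<open>supersolution_of_top_form\<close>). A monotone iteration below it
  converges to a solution on \<open>G\<close> (\<open>beyond_fixed_point\<close>), and an elementary computation turns the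
  solution into the tuple (\<open>edge_expr_of_fixed_point\<close>). The unknown attached to \<open>f\<close> is
  \<open>a\<^sub>f\<^sup>2\<close> times a Green function rather than the Green function, so that the ratios of \<open>\<phi>\<close> bound it
  also when \<open>a\<^sub>f = 0\<close>.
\<close>

section \<open>The Hilbert space of square-summable functions\<close>

text \<open>
  The functions live on the whole type, which makes the type a Hilbert space in the sense of the
  library; \<open>ell2 V\<close> consists of those functions that vanish off \<open>V\<close>.
\<close>

typedef 'v l2 = "{\<xi> :: 'v \<Rightarrow> complex. (\<lambda>v. (cmod (\<xi> v))\<^sup>2) summable_on UNIV}"
  morphisms ev l2_of
  by (rule exI[of _ "\<lambda>_. 0"]) simp

setup_lifting type_definition_l2

lemma inner_le_half_squares:
  fixes x y :: "'a::real_inner"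
  shows "\<bar>x \<bullet> y\<bar> \<le> ((norm x)\<^sup>2 + (norm y)\<^sup>2) / 2"
proof -
  have "\<bar>x \<bullet> y\<bar> \<le> norm x * norm y" by (rule Cauchy_Schwarz_ineq2)
  also have "\<dots> \<le> ((norm x)\<^sup>2 + (norm y)\<^sup>2) / 2"
    using sum_squares_bound[of "norm x" "norm y"] by simp
  finally show ?thesis .
qed

lemma summable_inner:
  fixes f g :: "'i \<Rightarrow> complex"
  assumes "(\<lambda>i. (cmod (f i))\<^sup>2) summable_on A" "(\<lambda>i. (cmod (g i))\<^sup>2) summable_on A"
  shows "(\<lambda>i. f i \<bullet> g i) summable_on A"
proof (rule abs_summable_summable, rule Infinite_Sum.abs_summable_on_comparison_test')
  show "(\<lambda>i. ((cmod (f i))\<^sup>2 + (cmod (g i))\<^sup>2) * (1 / 2)) summable_on A"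
    using assms by (intro summable_on_cmult_left summable_on_add)
  show "norm (f i \<bullet> g i) \<le> ((cmod (f i))\<^sup>2 + (cmod (g i))\<^sup>2) * (1 / 2)" for i
    using inner_le_half_squares[of "f i" "g i"] by simp
qed

lemma summable_square_add:
  fixes f g :: "'i \<Rightarrow> complex"
  assumes "(\<lambda>i. (cmod (f i))\<^sup>2) summable_on A" "(\<lambda>i. (cmod (g i))\<^sup>2) summable_on A"
  shows "(\<lambda>i. (cmod (f i + g i))\<^sup>2) summable_on A"
proof (rule summable_on_comparison_test)
  show "(\<lambda>i. 2 * ((cmod (f i))\<^sup>2 + (cmod (g i))\<^sup>2)) summable_on A"
    using assms by (intro summable_on_cmult_right summable_on_add)
  show "(cmod (f i + g i))\<^sup>2 \<le> 2 * ((cmod (f i))\<^sup>2 + (cmod (g i))\<^sup>2)" for i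
  proof -
    have "(cmod (f i + g i))\<^sup>2 \<le> (cmod (f i) + cmod (g i))\<^sup>2"
      by (intro power_mono norm_triangle_ineq) simp
    also have "\<dots> \<le> 2 * ((cmod (f i))\<^sup>2 + (cmod (g i))\<^sup>2)"
      using sum_squares_bound[of "cmod (f i)" "cmod (g i)"] by (simp add: power2_sum)
    finally show ?thesis .
  qed
qed simp

lemma summable_square_cmult:
  fixes f :: "'i \<Rightarrow> complex"
  assumes "(\<lambda>i. (cmod (f i))\<^sup>2) summable_on A"
  shows "(\<lambda>i. (cmod (c * f i))\<^sup>2) summable_on A"
  using summable_on_cmult_right[OF assms, of "(cmod c)\<^sup>2"] by (simp add: norm_mult power_mult_distrib)

lift_definition cmul :: "complex \<Rightarrow> 'v l2 \<Rightarrow> 'v l2" is "\<lambda>c \<xi> v. c * \<xi> v"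
  by (simp add: summable_square_cmult)

instantiation l2 :: (type) real_inner
begin

lift_definition zero_l2 :: "'a l2" is "\<lambda>_. 0" by simp
lift_definition plus_l2 :: "'a l2 \<Rightarrow> 'a l2 \<Rightarrow> 'a l2" is "\<lambda>\<xi> \<eta> v. \<xi> v + \<eta> v"
  by (simp add: summable_square_add)
lift_definition uminus_l2 :: "'a l2 \<Rightarrow> 'a l2" is "\<lambda>\<xi> v. - \<xi> v" by simp
lift_definition minus_l2 :: "'a l2 \<Rightarrow> 'a l2 \<Rightarrow> 'a l2" is "\<lambda>\<xi> \<eta> v. \<xi> v - \<eta> v"
  using summable_square_add[where g = "\<lambda>v. - _ v"] by simp
lift_definition scaleR_l2 :: "real \<Rightarrow> 'a l2 \<Rightarrow> 'a l2" is "\<lambda>r \<xi> v. r *\<^sub>R \<xi> v"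
  by (simp add: scaleR_conv_of_real summable_square_cmult)
lift_definition inner_l2 :: "'a l2 \<Rightarrow> 'a l2 \<Rightarrow> real" is "\<lambda>\<xi> \<eta>. \<Sum>\<^sub>\<infinity>v. \<xi> v \<bullet> \<eta> v" .

definition norm_l2 :: "'a l2 \<Rightarrow> real" where "norm_l2 \<xi> = sqrt (\<xi> \<bullet> \<xi>)"
definition dist_l2 :: "'a l2 \<Rightarrow> 'a l2 \<Rightarrow> real" where "dist_l2 \<xi> \<eta> = norm (\<xi> - \<eta>)"
definition sgn_l2 :: "'a l2 \<Rightarrow> 'a l2" where "sgn_l2 \<xi> = inverse (norm \<xi>) *\<^sub>R \<xi>"
definition uniformity_l2 :: "('a l2 \<times> 'a l2) filter" where
  "uniformity_l2 = (INF e\<in>{0<..}. principal {(x, y). dist x y < e})"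
definition open_l2 :: "'a l2 set \<Rightarrow> bool" where
  "open_l2 U = (\<forall>x\<in>U. \<forall>\<^sub>F (x', y) in uniformity. x' = x \<longrightarrow> y \<in> U)"

instance
proof
  fix x y z :: "'a l2" and a b r :: real
  show "x + y + z = x + (y + z)" "x + y = y + x" "0 + x = x" "- x + x = 0" "x - y = x + - y"
    "a *\<^sub>R (x + y) = a *\<^sub>R x + a *\<^sub>R y" "(a + b) *\<^sub>R x = a *\<^sub>R x + b *\<^sub>R x"
    "a *\<^sub>R b *\<^sub>R x = (a * b) *\<^sub>R x" "1 *\<^sub>R x = x"
    by (transfer; simp add: algebra_simps fun_eq_iff)+
  show "x \<bullet> y = y \<bullet> x" by transfer (simp add: inner_commute)
  show "(x + y) \<bullet> z = x \<bullet> z + y \<bullet> z"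
    by transfer (simp add: inner_add_left infsum_add summable_inner)
  show "(r *\<^sub>R x) \<bullet> y = r * (x \<bullet> y)"
    by transfer (simp add: infsum_cmult_right')
  show "0 \<le> x \<bullet> x" by transfer (simp add: infsum_nonneg)
  show "x \<bullet> x = 0 \<longleftrightarrow> x = 0"
  proof transfer
    fix \<xi> :: "'a \<Rightarrow> complex"
    assume "(\<lambda>v. (cmod (\<xi> v))\<^sup>2) summable_on UNIV"
    then have sm: "(\<lambda>v. \<xi> v \<bullet> \<xi> v) summable_on UNIV" by (simp add: power2_norm_eq_inner)
    show "((\<Sum>\<^sub>\<infinity>v. \<xi> v \<bullet> \<xi> v) = 0) = (\<xi> = (\<lambda>_. 0))"
    proof
      assume "(\<Sum>\<^sub>\<infinity>v. \<xi> v \<bullet> \<xi> v) = 0"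
      then have "\<xi> v \<bullet> \<xi> v = 0" for v
        by (intro nonneg_infsum_le_0D[OF _ sm]) auto
      then show "\<xi> = (\<lambda>_. 0)" by (intro ext) (simp only: inner_eq_zero_iff)
    qed simp
  qed
qed (fact norm_l2_def dist_l2_def sgn_l2_def uniformity_l2_def open_l2_def)+

end

lemmas ev_simps [simp] = zero_l2.rep_eq plus_l2.rep_eq uminus_l2.rep_eq minus_l2.rep_eq
  scaleR_l2.rep_eq cmul.rep_eq

lemma l2_eqI: "(\<And>v. ev \<xi> v = ev \<eta> v) \<Longrightarrow> \<xi> = \<eta>"
  by (metis ev_inject ext)

lemma summable_ev: "(\<lambda>v. (cmod (ev \<xi> v))\<^sup>2) summable_on UNIV"
  using ev[of \<xi>] by simp

lemma norm_l2_square: "(norm \<xi>)\<^sup>2 = (\<Sum>\<^sub>\<infinity>v. (cmod (ev \<xi> v))\<^sup>2)"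
  by (simp add: power2_norm_eq_inner inner_l2.rep_eq)

lemma sum_squares_le_norm_l2: "finite F \<Longrightarrow> (\<Sum>v\<in>F. (cmod (ev \<xi> v))\<^sup>2) \<le> (norm \<xi>)\<^sup>2"
  unfolding norm_l2_square by (rule finite_sum_le_infsum[OF summable_ev]) auto

lemma norm_ev_le: "cmod (ev \<xi> v) \<le> norm \<xi>"
proof (rule power2_le_imp_le)
  show "(cmod (ev \<xi> v))\<^sup>2 \<le> (norm \<xi>)\<^sup>2"
    using sum_squares_le_norm_l2[of "{v}" \<xi>]
    by simp
qed (rule norm_ge_zero)

lemma bounded_linear_ev: "bounded_linear (\<lambda>\<xi>. ev \<xi> v)"
  by (rule bounded_linear_intro[of _ 1]) (auto simp: norm_ev_le)

text \<open>
  Membership and norm are read off from finite partial sums. Bounds that survive pointwise limits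
  or finite manipulations therefore carry over to the space.
\<close>

lemma norm_l2_le_of_finite_sums:
  assumes "\<And>F. finite F \<Longrightarrow> (\<Sum>v\<in>F. (cmod (f v))\<^sup>2) \<le> C\<^sup>2" "0 \<le> C"
  shows "\<exists>\<xi>. ev \<xi> = f \<and> norm \<xi> \<le> C"
proof -
  have "(\<lambda>v. (cmod (f v))\<^sup>2) summable_on UNIV"
    by (rule nonneg_bdd_above_summable_on) (auto intro!: bdd_aboveI2[of _ _ "C\<^sup>2"] assms)
  then have ev: "ev (l2_of f) = f" by (simp add: l2_of_inverse)
  have "(norm (l2_of f))\<^sup>2 \<le> C\<^sup>2"
    unfolding norm_l2_square
    by (rule infsum_le_finite_sums[OF summable_ev]) (simp add: ev assms)
  then show ?thesis using ev assms(2) by (blast intro: power2_le_imp_le)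
qed

instance l2 :: (type) complete_space
proof
  fix X :: "nat \<Rightarrow> 'a l2"
  assume X: "Cauchy X"
  have "Cauchy (\<lambda>n. ev (X n) v)" for v
    by (rule bounded_linear.Cauchy[OF bounded_linear_ev X])
  then have "\<exists>l. (\<lambda>n. ev (X n) v) \<longlonglongrightarrow> l" for v
    by (simp add: Cauchy_convergent_iff convergent_def)
  then obtain L where L: "\<And>v. (\<lambda>n. ev (X n) v) \<longlonglongrightarrow> L v" by metis
  \<comment> \<open>The bound on differences passes to the pointwise limit on every finite set.\<close>
  have close: "\<exists>M. \<forall>m\<ge>M. \<exists>\<delta>. ev \<delta> = (\<lambda>v. ev (X m) v - L v) \<and> norm \<delta> \<le> e" if "e > 0" for e
  proof -
    from X \<open>e > 0\<close> obtain M where M: "\<And>m n. m \<ge> M \<Longrightarrow> n \<ge> M \<Longrightarrow> norm (X m - X n) < e"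
      unfolding Cauchy_iff by metis
    have "\<exists>\<delta>. ev \<delta> = (\<lambda>v. ev (X m) v - L v) \<and> norm \<delta> \<le> e" if "m \<ge> M" for m
    proof (rule norm_l2_le_of_finite_sums)
      fix F :: "'a set"
      assume F: "finite F"
      have "(\<lambda>n. \<Sum>v\<in>F. (cmod (ev (X m - X n) v))\<^sup>2) \<longlonglongrightarrow> (\<Sum>v\<in>F. (cmod (ev (X m) v - L v))\<^sup>2)"
        using L by (auto intro!: tendsto_intros)
      moreover have "\<forall>\<^sub>F n in sequentially. (\<Sum>v\<in>F. (cmod (ev (X m - X n) v))\<^sup>2) \<le> e\<^sup>2"
        using eventually_ge_at_top[of M]
      proof eventually_elim
        case (elim n)
        have "(\<Sum>v\<in>F. (cmod (ev (X m - X n) v))\<^sup>2) \<le> (norm (X m - X n))\<^sup>2"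
          by (rule sum_squares_le_norm_l2[OF F])
        also have "\<dots> \<le> e\<^sup>2" using M[OF that elim] by (intro power_mono) auto
        finally show ?case .
      qed
      ultimately show "(\<Sum>v\<in>F. (cmod (ev (X m) v - L v))\<^sup>2) \<le> e\<^sup>2"
        by (rule tendsto_upperbound) simp
    qed (use \<open>e > 0\<close> in simp)
    then show ?thesis by blast
  qed
  from close[of 1] obtain m \<delta> where \<delta>: "ev \<delta> = (\<lambda>v. ev (X m) v - L v)" by (meson le_refl zero_less_one)
  define Y where "Y = X m - \<delta>"
  have Y: "ev Y v = L v" for v by (simp add: Y_def \<delta>)
  have "X \<longlonglongrightarrow> Y"
  proof (rule LIMSEQ_I)
    fix r :: real assume "r > 0"
    then obtain M where M: "\<forall>m\<ge>M. \<exists>\<delta>. ev \<delta> = (\<lambda>v. ev (X m) v - L v) \<and> norm \<delta> \<le> r / 2"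
      using close[of "r / 2"] by auto
    show "\<exists>no. \<forall>n\<ge>no. norm (X n - Y) < r"
    proof (intro exI allI impI)
      fix n assume "n \<ge> M"
      then obtain \<delta> where \<delta>: "ev \<delta> = (\<lambda>v. ev (X n) v - L v)" "norm \<delta> \<le> r / 2" using M by blast
      have "X n - Y = \<delta>" by (rule l2_eqI) (simp add: \<delta> Y)
      then show "norm (X n - Y) < r" using \<delta> \<open>r > 0\<close> by simp
    qed
  qed
  then show "convergent X" by (auto simp: convergent_def)
qed

lemma cmul_add: "cmul c (\<xi> + \<eta>) = cmul c \<xi> + cmul c \<eta>"
  by (rule l2_eqI) (simp add: algebra_simps)

lemma inner_cmul_left: "cmul c \<xi> \<bullet> \<eta> = \<xi> \<bullet> cmul (cnj c) \<eta>"
  by (simp add: inner_l2.rep_eq inner_complex_def algebra_simps)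

lemma inner_cmul_self: "cmul c \<xi> \<bullet> \<xi> = Re c * (norm \<xi>)\<^sup>2"
proof -
  have "(c * ev \<xi> v) \<bullet> ev \<xi> v = Re c * (cmod (ev \<xi> v))\<^sup>2" for v
    by (simp add: inner_complex_def cmod_power2) (simp add: power2_eq_square algebra_simps)
  then show ?thesis
    by (simp add: inner_l2.rep_eq norm_l2_square infsum_cmult_right')
qed

lemma norm_cmul: "norm (cmul c \<xi>) = cmod c * norm \<xi>"
proof -
  have "(norm (cmul c \<xi>))\<^sup>2 = (cmod c * norm \<xi>)\<^sup>2"
    by (simp add: norm_l2_square norm_mult power_mult_distrib infsum_cmult_right')
  then show ?thesis by simp
qed

lemma bounded_linear_cmul: "bounded_linear (cmul c)"
proof (rule bounded_linear_intro)
  show "cmul c (r *\<^sub>R \<xi>) = r *\<^sub>R cmul c \<xi>" for r :: real and \<xi> :: "'v l2"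
    by (rule l2_eqI) simp
  show "norm (cmul c \<xi>) \<le> norm \<xi> * cmod c" for \<xi> :: "'v l2"
    by (simp add: norm_cmul)
qed (rule cmul_add)

definition supp_in :: "'v set \<Rightarrow> 'v l2 set" where
  "supp_in V = {\<xi>. \<forall>v. v \<notin> V \<longrightarrow> ev \<xi> v = 0}"

lemma subspace_supp_in: "subspace (supp_in V)"
  by (auto simp: subspace_def supp_in_def)

lemma cmul_supp_in: "\<xi> \<in> supp_in V \<Longrightarrow> cmul c \<xi> \<in> supp_in V"
  by (auto simp: supp_in_def)

lemma closed_supp_in: "closed (supp_in V)"
proof -
  have "closed {\<xi>. ev \<xi> v = 0}" for v :: 'v
    by (intro closed_Collect_eq bounded_linear.continuous_on[OF bounded_linear_ev] continuous_intros)
  then have "closed (\<Inter>v\<in>-V. {\<xi>. ev \<xi> v = 0})" by (intro closed_INT ballI)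
  also have "(\<Inter>v\<in>-V. {\<xi>. ev \<xi> v = 0}) = supp_in V" by (auto simp: supp_in_def)
  finally show ?thesis .
qed

lemma ev_supp_in:
  assumes "\<xi> \<in> supp_in V"
  shows "ev \<xi> \<in> ell2 V" "ell2_norm V (ev \<xi>) = norm \<xi>"
    and "(\<Sum>\<^sub>\<infinity>v\<in>V. (cmod (ev \<xi> v))\<^sup>2) = (norm \<xi>)\<^sup>2"
proof -
  have "(\<lambda>v. (cmod (ev \<xi> v))\<^sup>2) summable_on V"
    by (rule summable_on_subset[OF summable_ev]) simp
  then show "ev \<xi> \<in> ell2 V" using assms by (auto simp: ell2_def supp_in_def)
  show sq: "(\<Sum>\<^sub>\<infinity>v\<in>V. (cmod (ev \<xi> v))\<^sup>2) = (norm \<xi>)\<^sup>2"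
    unfolding norm_l2_square using assms
    by (intro infsum_cong_neutral) (auto simp: supp_in_def)
  show "ell2_norm V (ev \<xi>) = norm \<xi>" using sq by (simp add: ell2_norm_def)
qed

lemma ell2_eq: "ell2 V = ev ` supp_in V"
proof (rule subset_antisym)
  show "ell2 V \<subseteq> ev ` supp_in V"
  proof
    fix f assume f: "f \<in> ell2 V"
    then have "(\<lambda>v. (cmod (f v))\<^sup>2) summable_on UNIV \<longleftrightarrow> (\<lambda>v. (cmod (f v))\<^sup>2) summable_on V"
      by (intro summable_on_cong_neutral) (auto simp: ell2_def)
    with f have "ev (l2_of f) = f" by (intro l2_of_inverse) (auto simp: ell2_def)
    with f show "f \<in> ev ` supp_in V"
      by (intro image_eqI[of _ _ "l2_of f"]) (auto simp: ell2_def supp_in_def)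
  qed
qed (auto intro: ev_supp_in)

section \<open>Coercive operators\<close>

text \<open>
  The squared norm of \<open>\<xi> - t B \<xi>\<close> is \<open>|\<xi>|\<^sup>2 - 2 t (B \<xi> \<bullet> \<xi>) + t\<^sup>2 |B \<xi>|\<^sup>2\<close>.
  For small \<open>t\<close> the linear term, bounded by coercivity, dominates the quadratic one.
\<close>

lemma coercive_contraction:
  fixes B :: "'h::real_inner \<Rightarrow> 'h"
  assumes B: "bounded_linear B" and c: "0 < c"
    and coercive: "\<And>\<xi>. \<xi> \<in> S \<Longrightarrow> c * (norm \<xi>)\<^sup>2 \<le> B \<xi> \<bullet> \<xi>"
  shows "\<exists>t0>0. \<forall>t. 0 < t \<and> t \<le> t0 \<longrightarrow>
    (\<exists>q. 0 \<le> q \<and> q < 1 \<and> (\<forall>\<xi>\<in>S. norm (\<xi> - t *\<^sub>R B \<xi>) \<le> q * norm \<xi>))"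
proof -
  obtain C where C: "0 < C" "\<And>\<xi>. norm (B \<xi>) \<le> norm \<xi> * C"
    using bounded_linear.pos_bounded[OF B] by blast
  show ?thesis
  proof (rule exI[of _ "min (c / C\<^sup>2) (1 / c)"], intro conjI allI impI)
    fix t assume t: "0 < t \<and> t \<le> min (c / C\<^sup>2) (1 / c)"
    have tc: "t * c \<le> 1" "0 < t * c" and tC: "t * C\<^sup>2 \<le> c"
      using t c C(1) by (auto simp: field_simps)
    have "norm (\<xi> - t *\<^sub>R B \<xi>) \<le> sqrt (1 - t * c) * norm \<xi>" if "\<xi> \<in> S" for \<xi>
    proof (rule power2_le_imp_le)
      have "(norm (\<xi> - t *\<^sub>R B \<xi>))\<^sup>2 = (norm \<xi>)\<^sup>2 - 2 * t * (B \<xi> \<bullet> \<xi>) + t\<^sup>2 * (norm (B \<xi>))\<^sup>2"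
        unfolding power2_norm_eq_inner
        by (simp add: inner_diff_left inner_diff_right inner_commute power2_eq_square algebra_simps)
      also have "\<dots> \<le> (norm \<xi>)\<^sup>2 - 2 * t * (c * (norm \<xi>)\<^sup>2) + t\<^sup>2 * (norm \<xi> * C)\<^sup>2"
        using t coercive[OF that] C
        by (intro add_mono diff_mono mult_left_mono power_mono) auto
      also have "\<dots> = (1 - 2 * (t * c) + t * (t * C\<^sup>2)) * (norm \<xi>)\<^sup>2"
        by (simp add: power2_eq_square algebra_simps)
      also have "\<dots> \<le> (1 - 2 * (t * c) + t * c) * (norm \<xi>)\<^sup>2"
        using t tC by (intro mult_right_mono add_left_mono mult_left_mono) auto
      also have "\<dots> = (sqrt (1 - t * c) * norm \<xi>)\<^sup>2"
        using tc by (simp add: power_mult_distrib)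
      finally show "(norm (\<xi> - t *\<^sub>R B \<xi>))\<^sup>2 \<le> (sqrt (1 - t * c) * norm \<xi>)\<^sup>2" .
    qed (use tc in auto)
    with tc show "\<exists>q. 0 \<le> q \<and> q < 1 \<and> (\<forall>\<xi>\<in>S. norm (\<xi> - t *\<^sub>R B \<xi>) \<le> q * norm \<xi>)"
      by (intro exI[of _ "sqrt (1 - t * c)"]) auto
  qed (use c C in auto)
qed

text \<open>
  Lax-Milgram by fixed-point iteration: a fixed point of \<open>\<xi> \<mapsto> \<xi> - t B \<xi> + t \<eta>\<close> solves \<open>B \<xi> = \<eta>\<close>.
  Keeping the iteration inside a closed set \<open>K\<close> also locates the solution: the whole subspace gives
  solvability, and a cone gives a positive solution.
\<close>

lemma coercive_solution_in:
  fixes B :: "'h::{real_inner, complete_space} \<Rightarrow> 'h"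
  assumes B: "bounded_linear B" and c: "0 < c" and S: "subspace S"
    and coercive: "\<And>\<xi>. \<xi> \<in> S \<Longrightarrow> c * (norm \<xi>)\<^sup>2 \<le> B \<xi> \<bullet> \<xi>"
    and K: "closed K" "K \<noteq> {}" "K \<subseteq> S"
    and s: "0 < s" "\<And>t \<xi>. 0 < t \<Longrightarrow> t \<le> s \<Longrightarrow> \<xi> \<in> K \<Longrightarrow> \<xi> - t *\<^sub>R B \<xi> + t *\<^sub>R \<eta> \<in> K"
  shows "\<exists>\<xi>\<in>K. B \<xi> = \<eta>"
proof -
  obtain t0 where t0: "0 < t0" "\<forall>t. 0 < t \<and> t \<le> t0 \<longrightarrow>
      (\<exists>q. 0 \<le> q \<and> q < 1 \<and> (\<forall>\<xi>\<in>S. norm (\<xi> - t *\<^sub>R B \<xi>) \<le> q * norm \<xi>))"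
    using coercive_contraction[OF B c, of S] coercive by blast
  define t where "t = min t0 s"
  have t: "0 < t" "t \<le> t0" "t \<le> s" using t0(1) s(1) by (auto simp: t_def)
  from t0(2) t(1,2) obtain q where
    q: "0 \<le> q" "q < 1" "\<And>\<xi>. \<xi> \<in> S \<Longrightarrow> norm (\<xi> - t *\<^sub>R B \<xi>) \<le> q * norm \<xi>" by blast
  have "\<exists>!\<xi>\<in>K. \<xi> - t *\<^sub>R B \<xi> + t *\<^sub>R \<eta> = \<xi>"
  proof (rule Banach_fix)
    show "complete K" using K(1) by (simp add: complete_eq_closed)
    fix x y assume "x \<in> K" "y \<in> K"
    then have "x - y \<in> S" using K(3) S by (auto intro: subspace_diff)
    then have "norm ((x - y) - t *\<^sub>R B (x - y)) \<le> q * norm (x - y)" by (rule q)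
    then show "dist (x - t *\<^sub>R B x + t *\<^sub>R \<eta>) (y - t *\<^sub>R B y + t *\<^sub>R \<eta>) \<le> q * dist x y"
      by (simp add: dist_norm linear_diff[OF bounded_linear.linear[OF B]] algebra_simps)
  qed (use K q s(2) t in auto)
  then obtain \<xi> where "\<xi> \<in> K" "\<xi> - t *\<^sub>R B \<xi> + t *\<^sub>R \<eta> = \<xi>" by blast
  then have "t *\<^sub>R (\<eta> - B \<xi>) = 0" by (simp add: algebra_simps)
  with t \<open>\<xi> \<in> K\<close> show ?thesis by auto
qed

lemma coercive_lower_bound:
  fixes B :: "'h::real_inner \<Rightarrow> 'h"
  assumes "c * (norm \<xi>)\<^sup>2 \<le> B \<xi> \<bullet> \<xi>" "0 < c"
  shows "norm \<xi> \<le> norm (B \<xi>) / c"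
proof (cases "\<xi> = 0")
  case False
  have "c * (norm \<xi>)\<^sup>2 \<le> norm (B \<xi>) * norm \<xi>"
    using assms(1) norm_cauchy_schwarz[of "B \<xi>" \<xi>] by linarith
  with False assms(2) show ?thesis by (simp add: power2_eq_square field_simps)
qed (use assms in simp)

text \<open>
  If \<open>C\<close> bounds the norm of \<open>B\<close>, the nonnegativity of the form at \<open>\<xi> - (1 / C) B \<xi>\<close> reads
  \<open>0 \<le> (B \<xi> \<bullet> \<xi>) - |B \<xi>|\<^sup>2 / C\<close>.
\<close>

lemma norm_le_positive_form:
  fixes B :: "'h::real_inner \<Rightarrow> 'h"
  assumes B: "bounded_linear B" and S: "subspace S" and inv: "\<And>\<xi>. \<xi> \<in> S \<Longrightarrow> B \<xi> \<in> S"
    and sym: "\<And>\<xi> \<eta>. \<xi> \<in> S \<Longrightarrow> \<eta> \<in> S \<Longrightarrow> B \<xi> \<bullet> \<eta> = \<xi> \<bullet> B \<eta>"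
    and pos: "\<And>\<xi>. \<xi> \<in> S \<Longrightarrow> 0 \<le> B \<xi> \<bullet> \<xi>"
  shows "\<exists>C>0. \<forall>\<xi>\<in>S. (norm (B \<xi>))\<^sup>2 \<le> C * (B \<xi> \<bullet> \<xi>)"
proof -
  obtain C where C: "0 < C" "\<And>\<xi>. norm (B \<xi>) \<le> norm \<xi> * C"
    using bounded_linear.pos_bounded[OF B] by blast
  have "(norm (B \<xi>))\<^sup>2 \<le> C * (B \<xi> \<bullet> \<xi>)" if "\<xi> \<in> S" for \<xi>
  proof -
    define \<eta> where "\<eta> = B \<xi>"
    have \<eta>: "\<eta> \<in> S" using inv[OF that] by (simp add: \<eta>_def)
    have "B \<eta> \<bullet> \<eta> \<le> norm (B \<eta>) * norm \<eta>" by (rule norm_cauchy_schwarz)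
    also have "\<dots> \<le> (norm \<eta> * C) * norm \<eta>" by (intro mult_right_mono C) simp
    finally have up: "B \<eta> \<bullet> \<eta> \<le> C * (norm \<eta>)\<^sup>2" by (simp add: power2_eq_square algebra_simps)
    have sym_eq: "\<xi> \<bullet> B \<eta> = \<eta> \<bullet> \<eta>"
      using sym[OF that \<eta>] by (simp add: \<eta>_def[symmetric])
    have "0 \<le> B (\<xi> - (1 / C) *\<^sub>R \<eta>) \<bullet> (\<xi> - (1 / C) *\<^sub>R \<eta>)"
      using that \<eta> S by (intro pos) (auto intro: subspace_diff subspace_scale)
    also have "\<dots> = B \<xi> \<bullet> \<xi> - (2 / C) * (norm \<eta>)\<^sup>2 + (1 / C)\<^sup>2 * (B \<eta> \<bullet> \<eta>)"
      using sym_eq unfolding power2_norm_eq_inner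
      by (simp add: linear_diff[OF bounded_linear.linear[OF B]] linear_scale[OF bounded_linear.linear[OF B]]
          inner_diff_left inner_diff_right \<eta>_def[symmetric]
          inner_commute power2_eq_square algebra_simps)
    also have "\<dots> \<le> B \<xi> \<bullet> \<xi> - (2 / C) * (norm \<eta>)\<^sup>2 + (1 / C)\<^sup>2 * (C * (norm \<eta>)\<^sup>2)"
      by (intro add_left_mono mult_left_mono up) simp
    also have "\<dots> = B \<xi> \<bullet> \<xi> - (norm \<eta>)\<^sup>2 / C"
      using C(1) by (simp add: power2_eq_square field_simps)
    finally show ?thesis using C(1) by (simp add: \<eta>_def field_simps)
  qed
  with C(1) show ?thesis by blast
qed

section \<open>The right edge of the spectrum of a symmetric operator\<close>

locale symmetric_operator =
  fixes A :: "'v l2 \<Rightarrow> 'v l2" and V :: "'v set"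
  assumes bounded_A: "bounded_linear A"
    and A_cmul: "A (cmul c \<xi>) = cmul c (A \<xi>)"
    and A_supp: "\<xi> \<in> supp_in V \<Longrightarrow> A \<xi> \<in> supp_in V"
    and A_sym: "\<xi> \<in> supp_in V \<Longrightarrow> \<eta> \<in> supp_in V \<Longrightarrow> A \<xi> \<bullet> \<eta> = \<xi> \<bullet> A \<eta>"
    and V_nonempty: "V \<noteq> {}"
begin

definition top_form :: real where
  "top_form = Sup ((\<lambda>\<xi>. A \<xi> \<bullet> \<xi>) ` {\<xi> \<in> supp_in V. norm \<xi> = 1})"

lemma linear_A: "linear A"
  by (rule bounded_linear.linear[OF bounded_A])

lemma unit_vector_exists: "\<exists>\<xi>\<in>supp_in V. norm \<xi> = 1"
proof -
  obtain v where "v \<in> V" using V_nonempty by blast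
  define f :: "'v \<Rightarrow> complex" where "f = (\<lambda>w. if w = v then 1 else 0)"
  have "(\<lambda>w. (cmod (f w))\<^sup>2) summable_on UNIV \<longleftrightarrow> (\<lambda>w. (cmod (f w))\<^sup>2) summable_on {v}"
    by (intro summable_on_cong_neutral) (auto simp: f_def)
  then have ev: "ev (l2_of f) = f" by (intro l2_of_inverse) auto
  have "(\<Sum>\<^sub>\<infinity>w. (cmod (f w))\<^sup>2) = (\<Sum>\<^sub>\<infinity>w\<in>{v}. (cmod (f w))\<^sup>2)"
    by (intro infsum_cong_neutral) (auto simp: f_def)
  then have "(norm (l2_of f))\<^sup>2 = 1" unfolding norm_l2_square ev by (simp add: f_def)
  then have "norm (l2_of f) = 1"
    using power2_eq_iff_nonneg[of "norm (l2_of f)" 1] by simp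
  moreover have "l2_of f \<in> supp_in V" using \<open>v \<in> V\<close> by (simp add: supp_in_def ev) (auto simp: f_def)
  ultimately show ?thesis by blast
qed

lemma bdd_above_form: "bdd_above ((\<lambda>\<xi>. A \<xi> \<bullet> \<xi>) ` {\<xi> \<in> supp_in V. norm \<xi> = 1})"
proof -
  obtain C where C: "\<And>\<xi>. norm (A \<xi>) \<le> norm \<xi> * C"
    using bounded_linear.pos_bounded[OF bounded_A] by blast
  show ?thesis
  proof (rule bdd_aboveI2[of _ _ C])
    fix \<xi> assume "\<xi> \<in> {\<xi> \<in> supp_in V. norm \<xi> = 1}"
    then show "A \<xi> \<bullet> \<xi> \<le> C"
      using norm_cauchy_schwarz[of "A \<xi>" \<xi>] C[of \<xi>] by simp
  qed
qed

lemma form_le_top: 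
  assumes "\<xi> \<in> supp_in V"
  shows "A \<xi> \<bullet> \<xi> \<le> top_form * (norm \<xi>)\<^sup>2"
proof (cases "\<xi> = 0")
  case False
  define \<eta> where "\<eta> = (1 / norm \<xi>) *\<^sub>R \<xi>"
  have "\<eta> \<in> {\<xi> \<in> supp_in V. norm \<xi> = 1}"
    using False assms by (auto simp: \<eta>_def intro: subspace_scale[OF subspace_supp_in])
  then have "A \<eta> \<bullet> \<eta> \<le> top_form"
    unfolding top_form_def by (rule cSUP_upper[OF _ bdd_above_form])
  also have "A \<eta> \<bullet> \<eta> = (A \<xi> \<bullet> \<xi>) / (norm \<xi>)\<^sup>2"
    by (simp add: \<eta>_def linear_scale[OF linear_A] power2_eq_square)
  finally show ?thesis using False by (simp add: field_simps)
qed (simp add: linear_0[OF linear_A])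

lemma top_form_le: 
  assumes "\<And>\<xi>. \<xi> \<in> supp_in V \<Longrightarrow> A \<xi> \<bullet> \<xi> \<le> l * (norm \<xi>)\<^sup>2"
  shows "top_form \<le> l"
  unfolding top_form_def using unit_vector_exists assms by (intro cSUP_least) force+

lemma form_coercive:
  assumes "\<xi> \<in> supp_in V"
  shows "(l - top_form) * (norm \<xi>)\<^sup>2 \<le> (l *\<^sub>R \<xi> - A \<xi>) \<bullet> \<xi>"
  using form_le_top[OF assms] by (simp add: inner_diff_left power2_norm_eq_inner algebra_simps)

text \<open>
  The form of \<open>top_form - A\<close> is nonnegative and nearly vanishes at a unit vector that nearly
  attains the supremum; by \<open>norm_le_positive_form\<close> its image under \<open>top_form - A\<close> is then small.
\<close>

lemma approximate_eigenvector:
  assumes "0 < e"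
  shows "\<exists>\<xi>\<in>supp_in V. norm \<xi> = 1 \<and> norm (A \<xi> - top_form *\<^sub>R \<xi>) < e"
proof -
  define B where "B = (\<lambda>\<xi>. top_form *\<^sub>R \<xi> - A \<xi>)"
  have "\<exists>C>0. \<forall>\<xi>\<in>supp_in V. (norm (B \<xi>))\<^sup>2 \<le> C * (B \<xi> \<bullet> \<xi>)"
  proof (rule norm_le_positive_form[OF _ subspace_supp_in])
    show "bounded_linear B"
      unfolding B_def by (intro bounded_linear_sub bounded_linear_scaleR_right bounded_A)
    show "B \<xi> \<in> supp_in V" if "\<xi> \<in> supp_in V" for \<xi>
      using that A_supp[OF that] unfolding B_def
      by (intro subspace_diff subspace_scale subspace_supp_in)
    show "B \<xi> \<bullet> \<eta> = \<xi> \<bullet> B \<eta>" if "\<xi> \<in> supp_in V" "\<eta> \<in> supp_in V" for \<xi> \<eta>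
      using A_sym[OF that] by (simp add: B_def inner_diff_left inner_diff_right)
    show "0 \<le> B \<xi> \<bullet> \<xi>" if "\<xi> \<in> supp_in V" for \<xi>
      using form_coercive[OF that, of top_form] by (simp add: B_def)
  qed
  then obtain C where C: "0 < C" "\<And>\<xi>. \<xi> \<in> supp_in V \<Longrightarrow> (norm (B \<xi>))\<^sup>2 \<le> C * (B \<xi> \<bullet> \<xi>)"
    by blast
  have "top_form - e\<^sup>2 / C < Sup ((\<lambda>\<xi>. A \<xi> \<bullet> \<xi>) ` {\<xi> \<in> supp_in V. norm \<xi> = 1})"
    using C(1) assms by (simp add: top_form_def[symmetric])
  then obtain \<xi> where \<xi>: "\<xi> \<in> supp_in V" "norm \<xi> = 1" "top_form - e\<^sup>2 / C < A \<xi> \<bullet> \<xi>"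
    using unit_vector_exists less_cSUP_iff[OF _ bdd_above_form] by blast
  have "B \<xi> \<bullet> \<xi> < e\<^sup>2 / C"
    using \<xi> by (simp add: B_def inner_diff_left flip: power2_norm_eq_inner)
  then have "(norm (B \<xi>))\<^sup>2 < e\<^sup>2"
    using C(1) C(2)[OF \<xi>(1)] by (simp add: field_simps)
  then have "norm (B \<xi>) < e" by (rule power2_less_imp_less) (use assms in simp)
  then show ?thesis using \<xi> by (auto simp: B_def norm_minus_commute intro!: bexI[of _ \<xi>])
qed

text \<open>
  The form of \<open>A\<close> takes real values at most \<open>top_form\<close> on unit vectors, so the values of the
  complex form of \<open>A - z\<close> stay away from \<open>0\<close> on one side of a line. A factor \<open>\<omega>\<close> turns this side
  into a right half-plane, where the real part gives coercivity.
\<close>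

lemma rotated_coercive:
  assumes "Im z \<noteq> 0 \<or> top_form < Re z"
  shows "\<exists>\<omega> c. \<omega> \<noteq> 0 \<and> 0 < c \<and>
    (\<forall>\<xi>\<in>supp_in V. c * (norm \<xi>)\<^sup>2 \<le> cmul \<omega> (A \<xi> - cmul z \<xi>) \<bullet> \<xi>)"
proof (cases "Im z = 0")
  case True
  then have z: "z = complex_of_real (Re z)" by (simp add: complex_eq_iff)
  have "(Re z - top_form) * (norm \<xi>)\<^sup>2 \<le> cmul (- 1) (A \<xi> - cmul z \<xi>) \<bullet> \<xi>" if "\<xi> \<in> supp_in V" for \<xi>
  proof -
    have "cmul (- 1) (A \<xi> - cmul z \<xi>) = Re z *\<^sub>R \<xi> - A \<xi>"
      by (subst z, rule l2_eqI) (simp add: scaleR_conv_of_real)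
    then show ?thesis using form_coercive[OF that, of "Re z"] by simp
  qed
  then show ?thesis
    using assms True by (intro exI[of _ "- 1"] exI[of _ "Re z - top_form"]) auto
next
  case False
  define s where "s = sgn (Im z)"
  \<comment> \<open>A symmetric operator times an imaginary number is antisymmetric: only \<open>z\<close> contributes.\<close>
  have "\<bar>Im z\<bar> * (norm \<xi>)\<^sup>2 \<le> cmul (s * \<i>) (A \<xi> - cmul z \<xi>) \<bullet> \<xi>" if "\<xi> \<in> supp_in V" for \<xi>
  proof -
    have "cmul (s * \<i>) (A \<xi>) \<bullet> \<xi> = A \<xi> \<bullet> cmul (- (s * \<i>)) \<xi>"
      by (simp add: inner_cmul_left)
    also have "\<dots> = \<xi> \<bullet> A (cmul (- (s * \<i>)) \<xi>)"
      using that by (intro A_sym cmul_supp_in)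
    also have "\<dots> = - (cmul (s * \<i>) (A \<xi>) \<bullet> \<xi>)"
    proof -
      have "cmul (- (s * \<i>)) (A \<xi>) = - cmul (s * \<i>) (A \<xi>)" by (rule l2_eqI) simp
      then show ?thesis by (simp add: A_cmul inner_commute)
    qed
    finally have "cmul (s * \<i>) (A \<xi>) \<bullet> \<xi> = 0" by simp
    moreover have "cmul (s * \<i>) (A \<xi> - cmul z \<xi>) = cmul (s * \<i>) (A \<xi>) - cmul (s * \<i> * z) \<xi>"
      by (rule l2_eqI) (simp add: algebra_simps)
    ultimately show ?thesis
      using False by (simp add: inner_diff_left inner_cmul_self s_def abs_sgn mult.commute)
  qed
  then show ?thesis
    using False by (intro exI[of _ "s * \<i>"] exI[of _ "\<bar>Im z\<bar>"]) (auto simp: s_def sgn_if)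
qed

text \<open>
  The factor \<open>\<omega>\<close> of \<open>rotated_coercive\<close> brings Lax-Milgram to bear on \<open>A - z\<close>: solutions exist, and
  the coercive lower bound makes them unique and bounded by the data. Linearity of the inverse follows
  from uniqueness.
\<close>

lemma resolvent_exists:
  assumes A0: "\<And>\<xi>. \<xi> \<in> supp_in V \<Longrightarrow> A0 (ev \<xi>) = ev (A \<xi>)"
    and z: "Im z \<noteq> 0 \<or> top_form < Re z"
  shows "z \<notin> spectrum V A0"
proof -
  obtain \<omega> c where \<omega>: "\<omega> \<noteq> 0" and c: "0 < c"
    and coercive: "\<And>\<xi>. \<xi> \<in> supp_in V \<Longrightarrow> c * (norm \<xi>)\<^sup>2 \<le> cmul \<omega> (A \<xi> - cmul z \<xi>) \<bullet> \<xi>"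
    using rotated_coercive[OF z] by blast
  define D where "D = (\<lambda>\<xi>. A \<xi> - cmul z \<xi>)"
  define B where "B = (\<lambda>\<xi>. cmul \<omega> (D \<xi>))"
  have linD: "bounded_linear D"
    unfolding D_def by (intro bounded_linear_sub bounded_A bounded_linear_cmul)
  have linB: "bounded_linear B"
    unfolding B_def by (rule bounded_linear_compose[OF bounded_linear_cmul linD])
  have D_supp: "D \<xi> \<in> supp_in V" if "\<xi> \<in> supp_in V" for \<xi>
    unfolding D_def using that by (intro subspace_diff subspace_supp_in A_supp cmul_supp_in)
  have D_cmul: "D (cmul k \<xi>) = cmul k (D \<xi>)" for k \<xi>
    unfolding D_def A_cmul by (rule l2_eqI) (simp add: algebra_simps)
  have bound: "norm \<xi> \<le> (cmod \<omega> / c) * norm (D \<xi>)" if "\<xi> \<in> supp_in V" for \<xi>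
    using coercive_lower_bound[of c \<xi> B] coercive[OF that] c by (simp add: B_def D_def norm_cmul)
  have inj: "\<xi> = \<eta>" if "\<xi> \<in> supp_in V" "\<eta> \<in> supp_in V" "D \<xi> = D \<eta>" for \<xi> \<eta>
  proof -
    have "D (\<xi> - \<eta>) = 0" using that linear_diff[OF bounded_linear.linear[OF linD]] by simp
    then show ?thesis
      using bound[of "\<xi> - \<eta>"] that subspace_diff[OF subspace_supp_in] by fastforce
  qed
  have surj: "\<exists>\<xi>\<in>supp_in V. D \<xi> = \<eta>" if \<eta>: "\<eta> \<in> supp_in V" for \<eta>
  proof -
    have "\<exists>\<xi>\<in>supp_in V. B \<xi> = cmul \<omega> \<eta>"
    proof (rule coercive_solution_in[where s = 1, OF linB c subspace_supp_in _ closed_supp_in _ subset_refl])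
      show "\<xi> - t *\<^sub>R B \<xi> + t *\<^sub>R cmul \<omega> \<eta> \<in> supp_in V" if "\<xi> \<in> supp_in V" for t \<xi>
        unfolding B_def using that \<eta> D_supp
        by (intro subspace_add subspace_diff subspace_scale subspace_supp_in cmul_supp_in)
    qed (use coercive subspace_0[OF subspace_supp_in] in \<open>auto simp: B_def D_def\<close>)
    then obtain \<xi> where \<xi>: "\<xi> \<in> supp_in V" "cmul \<omega> (D \<xi>) = cmul \<omega> \<eta>" by (auto simp: B_def)
    have "cmul (1 / \<omega>) (cmul \<omega> x) = x" for x :: "'v l2" using \<omega> by (intro l2_eqI) simp
    with \<xi> show ?thesis by metis
  qed
  define sol where "sol = (\<lambda>\<eta>. SOME \<xi>. \<xi> \<in> supp_in V \<and> D \<xi> = \<eta>)"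
  have sol: "sol \<eta> \<in> supp_in V" "D (sol \<eta>) = \<eta>" if "\<eta> \<in> supp_in V" for \<eta>
    using someI_ex[of "\<lambda>\<xi>. \<xi> \<in> supp_in V \<and> D \<xi> = \<eta>"] surj[OF that] by (auto simp: sol_def)
  have solI: "sol \<eta> = \<xi>" if "\<xi> \<in> supp_in V" "D \<xi> = \<eta>" for \<xi> \<eta>
    using inj sol D_supp that by metis
  define R where "R = (\<lambda>f. ev (sol (l2_of f)))"
  have R: "R (ev \<xi>) = ev (sol \<xi>)" for \<xi> by (simp add: R_def ev_inverse)
  have A0_D: "(\<lambda>v. A0 (ev \<xi>) v - z * ev \<xi> v) = ev (D \<xi>)" if "\<xi> \<in> supp_in V" for \<xi>
    using A0[OF that] by (auto simp: D_def)
  have sol_add: "sol (\<xi> + \<eta>) = sol \<xi> + sol \<eta>" if "\<xi> \<in> supp_in V" "\<eta> \<in> supp_in V" for \<xi> \<eta>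
    using that sol linear_add[OF bounded_linear.linear[OF linD]]
    by (intro solI) (auto intro: subspace_add[OF subspace_supp_in])
  have sol_cmul: "sol (cmul k \<xi>) = cmul k (sol \<xi>)" if "\<xi> \<in> supp_in V" for k \<xi>
    using that sol by (intro solI) (auto intro: cmul_supp_in simp: D_cmul)
  have "bounded_operator V R"
    unfolding bounded_operator_def ell2_eq
  proof (intro conjI ballI allI)
    show "R f \<in> ev ` supp_in V" if "f \<in> ev ` supp_in V" for f
      using that sol by (auto simp: R)
    show "R (\<lambda>v. f v + g v) = (\<lambda>v. R f v + R g v)"
      if "f \<in> ev ` supp_in V" "g \<in> ev ` supp_in V" for f g
    proof -
      from that obtain \<xi> \<eta> where e: "\<xi> \<in> supp_in V" "f = ev \<xi>" "\<eta> \<in> supp_in V" "g = ev \<eta>" by blast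
      have "(\<lambda>v. f v + g v) = ev (\<xi> + \<eta>)" by (simp add: e plus_l2.rep_eq)
      then have "R (\<lambda>v. f v + g v) = ev (sol (\<xi> + \<eta>))" by (simp only: R)
      then show ?thesis using e sol_add by (simp add: R)
    qed
    show "R (\<lambda>v. k * f v) = (\<lambda>v. k * R f v)" if "f \<in> ev ` supp_in V" for k f
    proof -
      from that obtain \<xi> where e: "\<xi> \<in> supp_in V" "f = ev \<xi>" by blast
      have "(\<lambda>v. k * f v) = ev (cmul k \<xi>)" by (simp add: e cmul.rep_eq)
      then have "R (\<lambda>v. k * f v) = ev (sol (cmul k \<xi>))" by (simp only: R)
      then show ?thesis using e sol_cmul by (simp add: R)
    qed
    have "ell2_norm V (R f) \<le> cmod \<omega> / c * ell2_norm V f" if "f \<in> ev ` supp_in V" for f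
    proof -
      from that obtain \<xi> where e: "\<xi> \<in> supp_in V" "f = ev \<xi>" by blast
      show ?thesis using bound[OF sol(1)[OF e(1)]] sol(2)[OF e(1)] e
        by (simp add: R ev_supp_in(2) sol(1))
    qed
    then show "\<exists>C. \<forall>f\<in>ev ` supp_in V. ell2_norm V (R f) \<le> C * ell2_norm V f" by blast
  qed
  moreover have "R (\<lambda>v. A0 f v - z * f v) = f" if "f \<in> ell2 V" for f
    using that solI by (auto simp: ell2_eq A0_D R)
  moreover have "(\<lambda>v. A0 (R f) v - z * R f v) = f" if "f \<in> ell2 V" for f
    using that sol by (auto simp: ell2_eq A0_D R)
  ultimately show ?thesis by (auto simp: spectrum_def)
qed

text \<open>
  Off the half-line that ends at \<open>top_form\<close> there is a resolvent; at \<open>top_form\<close> itself a bounded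
  inverse would send the tiny images of the approximate eigenvectors back to unit vectors.
\<close>

theorem is_right_edge_top_form:
  assumes A0: "\<And>\<xi>. \<xi> \<in> supp_in V \<Longrightarrow> A0 (ev \<xi>) = ev (A \<xi>)"
  shows "is_right_edge (spectrum V A0) top_form"
  unfolding is_right_edge_def
proof (intro conjI ballI)
  have z: "Im z = 0 \<and> Re z \<le> top_form" if "z \<in> spectrum V A0" for z
    using resolvent_exists[of A0 z] A0 that by (meson not_less)
  show "z \<in> \<real>" "Re z \<le> top_form" if "z \<in> spectrum V A0" for z
    using z[OF that] by (simp_all add: complex_is_Real_iff)
  show "complex_of_real top_form \<in> spectrum V A0"
    unfolding spectrum_def
  proof (rule CollectI, rule notI, elim exE conjE)
    fix R
    assume R: "bounded_operator V R"
      and inv: "\<forall>f\<in>ell2 V. R (\<lambda>v. A0 f v - complex_of_real top_form * f v) = f"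
    from R obtain C where C: "\<forall>f\<in>ell2 V. ell2_norm V (R f) \<le> C * ell2_norm V f"
      unfolding bounded_operator_def by blast
    have "0 < 1 / (\<bar>C\<bar> + 1)" by (simp add: add_nonneg_pos)
    then obtain \<xi> where \<xi>: "\<xi> \<in> supp_in V" "norm \<xi> = 1"
      "norm (A \<xi> - top_form *\<^sub>R \<xi>) < 1 / (\<bar>C\<bar> + 1)"
      using approximate_eigenvector by blast
    define \<eta> where "\<eta> = A \<xi> - top_form *\<^sub>R \<xi>"
    have \<eta>: "\<eta> \<in> supp_in V"
      unfolding \<eta>_def using \<xi> by (intro subspace_diff subspace_scale subspace_supp_in A_supp)
    have "(\<lambda>v. A0 (ev \<xi>) v - complex_of_real top_form * ev \<xi> v) = ev \<eta>"
      using A0[OF \<xi>(1)] by (auto simp: \<eta>_def scaleR_conv_of_real)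
    then have "R (ev \<eta>) = ev \<xi>" using inv ev_supp_in(1)[OF \<xi>(1)] by auto
    then have "1 \<le> C * norm \<eta>"
      using C ev_supp_in[OF \<eta>] ev_supp_in(2)[OF \<xi>(1)] \<xi>(2) by force
    also have "\<dots> \<le> \<bar>C\<bar> * (1 / (\<bar>C\<bar> + 1))"
      using \<xi>(3) by (intro mult_mono) (auto simp: \<eta>_def)
    also have "\<dots> < 1" by (simp add: field_simps)
    finally show False by simp
  qed
qed

end

section \<open>Jacobi matrices of graphs with bounded degree\<close>

locale bounded_jacobi = bidirected_digraph T rev
  for T :: "('v, 'e) pre_digraph" and rev :: "'e \<Rightarrow> 'e" +
  fixes a :: "'e \<Rightarrow> real" and b :: "'v \<Rightarrow> real" and d :: nat and K :: real
  assumes finite_out: "finite (out_arcs T u)"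
    and card_out: "card (out_arcs T u) \<le> d"
    and a_bound: "e \<in> arcs T \<Longrightarrow> \<bar>a e\<bar> \<le> K"
    and a_rev: "e \<in> arcs T \<Longrightarrow> a (rev e) = a e"
    and b_bound: "u \<in> verts T \<Longrightarrow> \<bar>b u\<bar> \<le> K"
    and verts_nonempty: "verts T \<noteq> {}"
begin

lemma bij_arcs: "bij_betw (\<lambda>e. (tail T e, e)) (arcs T) (Sigma (verts T) (out_arcs T))"
  by (rule bij_betw_byWitness[where f' = snd]) auto

lemma arcs_sum:
  fixes f :: "'e \<Rightarrow> real"
  assumes "f summable_on arcs T"
  shows "(\<lambda>u. \<Sum>e\<in>out_arcs T u. f e) summable_on verts T"
    and "(\<Sum>\<^sub>\<infinity>e\<in>arcs T. f e) = (\<Sum>\<^sub>\<infinity>u\<in>verts T. \<Sum>e\<in>out_arcs T u. f e)"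
proof -
  have sm: "(\<lambda>p. f (snd p)) summable_on Sigma (verts T) (out_arcs T)"
    using summable_on_reindex_bij_betw[OF bij_arcs, of "\<lambda>p. f (snd p)"] assms by simp
  have eq: "(\<Sum>\<^sub>\<infinity>e\<in>out_arcs T u. f e) = (\<Sum>e\<in>out_arcs T u. f e)" for u
    by (simp add: finite_out)
  show "(\<lambda>u. \<Sum>e\<in>out_arcs T u. f e) summable_on verts T"
    using summable_on_Sigma_banach[of "\<lambda>_ e. f e" "verts T" "out_arcs T"] sm
    by (simp add: eq case_prod_unfold)
  have "(\<Sum>\<^sub>\<infinity>e\<in>arcs T. f e) = (\<Sum>\<^sub>\<infinity>p\<in>Sigma (verts T) (out_arcs T). f (snd p))"
    using infsum_reindex_bij_betw[OF bij_arcs, of "\<lambda>p. f (snd p)"] by simp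
  also have "\<dots> = (\<Sum>\<^sub>\<infinity>u\<in>verts T. \<Sum>\<^sub>\<infinity>e\<in>out_arcs T u. f e)"
    using infsum_Sigma_banach[OF sm] by simp
  finally show "(\<Sum>\<^sub>\<infinity>e\<in>arcs T. f e) = (\<Sum>\<^sub>\<infinity>u\<in>verts T. \<Sum>e\<in>out_arcs T u. f e)"
    by (simp add: eq)
qed

lemma arcs_summableI:
  fixes f :: "'e \<Rightarrow> real"
  assumes "\<And>e. e \<in> arcs T \<Longrightarrow> 0 \<le> f e"
    and "(\<lambda>u. \<Sum>e\<in>out_arcs T u. f e) summable_on verts T"
  shows "f summable_on arcs T"
proof -
  have "(\<lambda>p. f (snd p)) summable_on Sigma (verts T) (out_arcs T)"
    using assms by (intro summable_on_SigmaI[OF _ assms(2)]) (auto simp: finite_out)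
  then show ?thesis
    using summable_on_reindex_bij_betw[OF bij_arcs, of "\<lambda>p. f (snd p)"] by simp
qed

lemma bij_rev: "bij_betw rev (arcs T) (arcs T)"
  by (rule bij_betw_byWitness[where f' = rev]) auto

lemma summable_verts: "(\<lambda>u. (cmod (ev \<xi> u))\<^sup>2) summable_on verts T"
  by (rule summable_on_subset[OF summable_ev]) simp

lemma infsum_verts_le: "(\<Sum>\<^sub>\<infinity>u\<in>verts T. (cmod (ev \<xi> u))\<^sup>2) \<le> (norm \<xi>)\<^sup>2"
  unfolding norm_l2_square by (rule infsum_mono2[OF summable_verts summable_ev]) auto

text \<open>
  Grouping arcs by their tails turns a sum over arcs into a sum over vertices, and reversing all
  arcs exchanges heads and tails. Boundedness, symmetry and the upper bound on the form of a Jacobi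
  matrix all reduce to these two reindexings.
\<close>

lemma arcs_weighted_tail:
  assumes w: "\<And>e. e \<in> arcs T \<Longrightarrow> 0 \<le> w e"
    and M: "\<And>u. u \<in> verts T \<Longrightarrow> (\<Sum>e\<in>out_arcs T u. w e) \<le> M"
  shows "(\<lambda>e. w e * (cmod (ev \<xi> (tail T e)))\<^sup>2) summable_on arcs T"
    and "(\<lambda>e. w (rev e) * (cmod (ev \<xi> (head T e)))\<^sup>2) summable_on arcs T"
    and "(\<Sum>\<^sub>\<infinity>e\<in>arcs T. w (rev e) * (cmod (ev \<xi> (head T e)))\<^sup>2)
      = (\<Sum>\<^sub>\<infinity>e\<in>arcs T. w e * (cmod (ev \<xi> (tail T e)))\<^sup>2)"
    and "(\<Sum>\<^sub>\<infinity>e\<in>arcs T. w e * (cmod (ev \<xi> (tail T e)))\<^sup>2)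
      = (\<Sum>\<^sub>\<infinity>u\<in>verts T. (\<Sum>e\<in>out_arcs T u. w e) * (cmod (ev \<xi> u))\<^sup>2)"
    and "(\<lambda>u. (\<Sum>e\<in>out_arcs T u. w e) * (cmod (ev \<xi> u))\<^sup>2) summable_on verts T"
proof -
  let ?f = "\<lambda>e. w e * (cmod (ev \<xi> (tail T e)))\<^sup>2"
  have eq: "(\<Sum>e\<in>out_arcs T u. ?f e) = (\<Sum>e\<in>out_arcs T u. w e) * (cmod (ev \<xi> u))\<^sup>2" for u
    by (simp add: sum_distrib_right)
  show sm: "?f summable_on arcs T"
  proof (rule arcs_summableI)
    show "(\<lambda>u. \<Sum>e\<in>out_arcs T u. ?f e) summable_on verts T"
      unfolding eq
    proof (rule summable_on_comparison_test)
      show "(\<lambda>u. M * (cmod (ev \<xi> u))\<^sup>2) summable_on verts T"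
        by (rule summable_on_cmult_right[OF summable_verts])
    qed (auto intro!: mult_right_mono M mult_nonneg_nonneg sum_nonneg w)
  qed (simp add: w)
  have rev: "w (rev e) * (cmod (ev \<xi> (head T e)))\<^sup>2 = ?f (rev e)" if "e \<in> arcs T" for e
    using that by simp
  show "(\<lambda>e. w (rev e) * (cmod (ev \<xi> (head T e)))\<^sup>2) summable_on arcs T"
    using summable_on_reindex_bij_betw[OF bij_rev, of ?f] sm by (simp only: summable_on_cong[OF rev])
  show "(\<Sum>\<^sub>\<infinity>e\<in>arcs T. w (rev e) * (cmod (ev \<xi> (head T e)))\<^sup>2) = (\<Sum>\<^sub>\<infinity>e\<in>arcs T. ?f e)"
    using infsum_reindex_bij_betw[OF bij_rev, of ?f] by (simp only: infsum_cong[OF rev])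
  show "(\<Sum>\<^sub>\<infinity>e\<in>arcs T. ?f e) = (\<Sum>\<^sub>\<infinity>u\<in>verts T. (\<Sum>e\<in>out_arcs T u. w e) * (cmod (ev \<xi> u))\<^sup>2)"
    using arcs_sum(2)[OF sm] by (simp only: eq)
  show "(\<lambda>u. (\<Sum>e\<in>out_arcs T u. w e) * (cmod (ev \<xi> u))\<^sup>2) summable_on verts T"
    using arcs_sum(1)[OF sm] by (simp only: eq)
qed

lemma summable_tail: "(\<lambda>e. (cmod (ev \<xi> (tail T e)))\<^sup>2) summable_on arcs T"
  and summable_head: "(\<lambda>e. (cmod (ev \<xi> (head T e)))\<^sup>2) summable_on arcs T"
  using arcs_weighted_tail(1,2)[where w = "\<lambda>_. 1" and M = d] card_out by auto

lemma infsum_head_le: "(\<Sum>\<^sub>\<infinity>e\<in>arcs T. (cmod (ev \<xi> (head T e)))\<^sup>2) \<le> d * (norm \<xi>)\<^sup>2"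
proof -
  have "(\<Sum>\<^sub>\<infinity>e\<in>arcs T. (cmod (ev \<xi> (head T e)))\<^sup>2)
      = (\<Sum>\<^sub>\<infinity>u\<in>verts T. card (out_arcs T u) * (cmod (ev \<xi> u))\<^sup>2)"
    using arcs_weighted_tail(3,4)[where w = "\<lambda>_. 1" and M = d and \<xi> = \<xi>] card_out by simp
  also have "\<dots> \<le> (\<Sum>\<^sub>\<infinity>u\<in>verts T. d * (cmod (ev \<xi> u))\<^sup>2)"
    using arcs_weighted_tail(5)[where w = "\<lambda>_. 1" and M = d and \<xi> = \<xi>] card_out
    by (intro infsum_mono summable_on_cmult_right summable_verts mult_right_mono) auto
  also have "\<dots> \<le> d * (norm \<xi>)\<^sup>2"
    using infsum_verts_le[of \<xi>] by (simp add: infsum_cmult_right' mult_left_mono)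
  finally show ?thesis .
qed

lemma K_nonneg: "0 \<le> K"
  using verts_nonempty b_bound by force

lemma jacobi_pointwise_bound:
  assumes "u \<in> verts T"
  shows "(cmod (jacobi_matrix T a b f u))\<^sup>2 \<le>
    2 * K\<^sup>2 * (cmod (f u))\<^sup>2 + 2 * d * K\<^sup>2 * (\<Sum>e\<in>out_arcs T u. (cmod (f (head T e)))\<^sup>2)"
proof -
  let ?x = "cmod (f u)" and ?S = "\<Sum>e\<in>out_arcs T u. cmod (f (head T e))"
  have "cmod (jacobi_matrix T a b f u) \<le> \<bar>b u\<bar> * ?x + (\<Sum>e\<in>out_arcs T u. \<bar>a e\<bar> * cmod (f (head T e)))"
    using assms unfolding jacobi_matrix_def
    by (auto intro!: norm_triangle_le add_mono sum_norm_le simp: norm_mult)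
  also have "\<dots> \<le> K * ?x + (\<Sum>e\<in>out_arcs T u. K * cmod (f (head T e)))"
    using assms by (intro add_mono mult_right_mono sum_mono a_bound b_bound) auto
  also have "\<dots> = K * (?x + ?S)" by (simp add: sum_distrib_left distrib_left)
  finally have "(cmod (jacobi_matrix T a b f u))\<^sup>2 \<le> (K * (?x + ?S))\<^sup>2"
    by (intro power_mono) auto
  also have "\<dots> \<le> K\<^sup>2 * (2 * ?x\<^sup>2 + 2 * ?S\<^sup>2)"
    unfolding power_mult_distrib using sum_squares_bound[of ?x ?S]
    by (intro mult_left_mono) (auto simp: power2_sum)
  also have "\<dots> \<le> K\<^sup>2 * (2 * ?x\<^sup>2 + 2 * (d * (\<Sum>e\<in>out_arcs T u. (cmod (f (head T e)))\<^sup>2)))"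
  proof (intro mult_left_mono add_left_mono)
    have "?S\<^sup>2 \<le> real (card (out_arcs T u)) * (\<Sum>e\<in>out_arcs T u. (cmod (f (head T e)))\<^sup>2)"
      using sum_squared_le_sum_of_squares[of "\<lambda>e. cmod (f (head T e))" "out_arcs T u"]
      by (simp add: mult.commute)
    also have "\<dots> \<le> d * (\<Sum>e\<in>out_arcs T u. (cmod (f (head T e)))\<^sup>2)"
      using card_out by (intro mult_right_mono sum_nonneg) auto
    finally show "?S\<^sup>2 \<le> d * (\<Sum>e\<in>out_arcs T u. (cmod (f (head T e)))\<^sup>2)" .
  qed auto
  finally show ?thesis by (simp add: algebra_simps)
qed

lemma jacobi_l2:
  "\<exists>\<eta>. ev \<eta> = jacobi_matrix T a b (ev \<xi>) \<and> norm \<eta> \<le> norm \<xi> * sqrt (2 * K\<^sup>2 + 2 * d * K\<^sup>2 * d)"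
proof (rule norm_l2_le_of_finite_sums)
  fix F :: "'v set" assume F: "finite F"
  let ?J = "jacobi_matrix T a b (ev \<xi>)"
  let ?h = "\<lambda>u. \<Sum>e\<in>out_arcs T u. (cmod (ev \<xi> (head T e)))\<^sup>2"
  have "(\<Sum>u\<in>F. (cmod (?J u))\<^sup>2) = (\<Sum>u\<in>F \<inter> verts T. (cmod (?J u))\<^sup>2)"
    by (rule sum.mono_neutral_right[OF F]) (auto simp: jacobi_matrix_def)
  also have "\<dots> \<le> (\<Sum>u\<in>F \<inter> verts T. 2 * K\<^sup>2 * (cmod (ev \<xi> u))\<^sup>2 + 2 * d * K\<^sup>2 * ?h u)"
    by (intro sum_mono jacobi_pointwise_bound) auto
  also have "\<dots> = 2 * K\<^sup>2 * (\<Sum>u\<in>F \<inter> verts T. (cmod (ev \<xi> u))\<^sup>2) + 2 * d * K\<^sup>2 * (\<Sum>u\<in>F \<inter> verts T. ?h u)"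
    by (simp only: sum.distrib sum_distrib_left)
  also have "\<dots> \<le> 2 * K\<^sup>2 * (norm \<xi>)\<^sup>2 + 2 * d * K\<^sup>2 * (d * (norm \<xi>)\<^sup>2)"
  proof (intro add_mono mult_left_mono)
    show "(\<Sum>u\<in>F \<inter> verts T. (cmod (ev \<xi> u))\<^sup>2) \<le> (norm \<xi>)\<^sup>2"
      using F by (intro sum_squares_le_norm_l2) auto
    have "(\<Sum>u\<in>F \<inter> verts T. ?h u) \<le> (\<Sum>\<^sub>\<infinity>u\<in>verts T. ?h u)"
      using F by (intro finite_sum_le_infsum arcs_sum(1) summable_head) (auto intro: sum_nonneg)
    also have "\<dots> \<le> d * (norm \<xi>)\<^sup>2"
      using infsum_head_le[of \<xi>] arcs_sum(2)[OF summable_head] by simp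
    finally show "(\<Sum>u\<in>F \<inter> verts T. ?h u) \<le> d * (norm \<xi>)\<^sup>2" .
  qed auto
  also have "\<dots> = (norm \<xi> * sqrt (2 * K\<^sup>2 + 2 * d * K\<^sup>2 * d))\<^sup>2"
    by (simp add: power_mult_distrib algebra_simps)
  finally show "(\<Sum>u\<in>F. (cmod (?J u))\<^sup>2) \<le> (norm \<xi> * sqrt (2 * K\<^sup>2 + 2 * d * K\<^sup>2 * d))\<^sup>2" .
qed auto

definition J :: "'v l2 \<Rightarrow> 'v l2" where
  "J \<xi> = l2_of (jacobi_matrix T a b (ev \<xi>))"

lemma ev_J: "ev (J \<xi>) = jacobi_matrix T a b (ev \<xi>)"
  using jacobi_l2[of \<xi>] by (metis J_def ev_inverse)

lemma norm_J: "norm (J \<xi>) \<le> norm \<xi> * sqrt (2 * K\<^sup>2 + 2 * d * K\<^sup>2 * d)"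
  using jacobi_l2[of \<xi>] by (metis J_def ev_inverse)

lemma bounded_linear_J: "bounded_linear J"
proof (rule bounded_linear_intro[OF _ _ norm_J])
  show "J (\<xi> + \<eta>) = J \<xi> + J \<eta>" for \<xi> \<eta>
    by (rule l2_eqI) (simp add: ev_J jacobi_matrix_def sum.distrib algebra_simps)
  show "J (r *\<^sub>R \<xi>) = r *\<^sub>R J \<xi>" for r \<xi>
    by (rule l2_eqI) (simp add: ev_J jacobi_matrix_def scaleR_right.sum scaleR_conv_of_real sum_distrib_left algebra_simps)
qed

lemma summable_arc_form:
  "(\<lambda>e. a e * (ev \<xi> (head T e) \<bullet> ev \<eta> (tail T e))) summable_on arcs T"
proof -
  have "(\<lambda>e. (cmod (complex_of_real (a e) * ev \<xi> (head T e)))\<^sup>2) summable_on arcs T"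
  proof (rule summable_on_comparison_test)
    show "(\<lambda>e. K\<^sup>2 * (cmod (ev \<xi> (head T e)))\<^sup>2) summable_on arcs T"
      by (rule summable_on_cmult_right[OF summable_head])
    show "(cmod (complex_of_real (a e) * ev \<xi> (head T e)))\<^sup>2 \<le> K\<^sup>2 * (cmod (ev \<xi> (head T e)))\<^sup>2"
      if "e \<in> arcs T" for e
      using a_bound[OF that] K_nonneg
      by (auto simp: norm_mult power_mult_distrib abs_le_square_iff[symmetric] intro!: mult_right_mono)
  qed simp
  from summable_inner[OF this summable_tail[of \<eta>]] show ?thesis
    by (simp add: inner_complex_def algebra_simps)
qed

lemma summable_vertex_form: "(\<lambda>u. b u * (ev \<xi> u \<bullet> ev \<eta> u)) summable_on verts T"
proof -
  have "(\<lambda>u. (cmod (complex_of_real (b u) * ev \<xi> u))\<^sup>2) summable_on verts T"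
  proof (rule summable_on_comparison_test)
    show "(\<lambda>u. K\<^sup>2 * (cmod (ev \<xi> u))\<^sup>2) summable_on verts T"
      by (rule summable_on_cmult_right[OF summable_verts])
    show "(cmod (complex_of_real (b u) * ev \<xi> u))\<^sup>2 \<le> K\<^sup>2 * (cmod (ev \<xi> u))\<^sup>2" if "u \<in> verts T" for u
      using b_bound[OF that] K_nonneg
      by (auto simp: norm_mult power_mult_distrib abs_le_square_iff[symmetric] intro!: mult_right_mono)
  qed simp
  from summable_inner[OF this summable_verts[of \<eta>]] show ?thesis
    by (simp add: inner_complex_def algebra_simps)
qed

lemma J_form:
  "J \<xi> \<bullet> \<eta> = (\<Sum>\<^sub>\<infinity>u\<in>verts T. b u * (ev \<xi> u \<bullet> ev \<eta> u))
    + (\<Sum>\<^sub>\<infinity>e\<in>arcs T. a e * (ev \<xi> (head T e) \<bullet> ev \<eta> (tail T e)))"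
proof -
  let ?g = "\<lambda>e. a e * (ev \<xi> (head T e) \<bullet> ev \<eta> (tail T e))"
  have "J \<xi> \<bullet> \<eta> = (\<Sum>\<^sub>\<infinity>u. jacobi_matrix T a b (ev \<xi>) u \<bullet> ev \<eta> u)"
    by (simp add: inner_l2.rep_eq ev_J)
  also have "\<dots> = (\<Sum>\<^sub>\<infinity>u\<in>verts T. b u * (ev \<xi> u \<bullet> ev \<eta> u) + (\<Sum>e\<in>out_arcs T u. ?g e))"
  proof (rule infsum_cong_neutral)
    show "jacobi_matrix T a b (ev \<xi>) u \<bullet> ev \<eta> u = b u * (ev \<xi> u \<bullet> ev \<eta> u) + (\<Sum>e\<in>out_arcs T u. ?g e)"
      if "u \<in> UNIV \<inter> verts T" for u
      using that by (auto simp: jacobi_matrix_def inner_add_left inner_sum_left inner_mult_left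
          intro!: sum.cong simp flip: scaleR_conv_of_real)
  qed (auto simp: jacobi_matrix_def)
  also have "\<dots> = (\<Sum>\<^sub>\<infinity>u\<in>verts T. b u * (ev \<xi> u \<bullet> ev \<eta> u)) + (\<Sum>\<^sub>\<infinity>u\<in>verts T. \<Sum>e\<in>out_arcs T u. ?g e)"
    by (intro infsum_add summable_vertex_form arcs_sum(1) summable_arc_form)
  also have "(\<Sum>\<^sub>\<infinity>u\<in>verts T. \<Sum>e\<in>out_arcs T u. ?g e) = (\<Sum>\<^sub>\<infinity>e\<in>arcs T. ?g e)"
    by (rule arcs_sum(2)[OF summable_arc_form, symmetric])
  finally show ?thesis .
qed

lemma J_sym: "J \<xi> \<bullet> \<eta> = \<xi> \<bullet> J \<eta>"
proof -
  let ?g = "\<lambda>e. a e * (ev \<xi> (head T e) \<bullet> ev \<eta> (tail T e))"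
  have "(\<Sum>\<^sub>\<infinity>e\<in>arcs T. ?g e) = (\<Sum>\<^sub>\<infinity>e\<in>arcs T. ?g (rev e))"
    using infsum_reindex_bij_betw[OF bij_rev, of ?g] by simp
  also have "\<dots> = (\<Sum>\<^sub>\<infinity>e\<in>arcs T. a e * (ev \<eta> (head T e) \<bullet> ev \<xi> (tail T e)))"
    by (rule infsum_cong) (simp add: a_rev inner_commute)
  finally show ?thesis by (simp add: J_form inner_commute[of \<xi>] inner_commute[of "ev \<xi> _"])
qed

sublocale symmetric_operator J "verts T"
proof (rule symmetric_operator.intro)
  show "J (cmul c \<xi>) = cmul c (J \<xi>)" for c \<xi>
    by (rule l2_eqI) (simp add: ev_J jacobi_matrix_def sum_distrib_left algebra_simps)
  show "J \<xi> \<in> supp_in (verts T)" for \<xi>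
    by (auto simp: supp_in_def ev_J jacobi_matrix_def)
qed (simp_all add: bounded_linear_J J_sym verts_nonempty)

lemma right_edge: "is_right_edge (spectrum (verts T) (jacobi_matrix T a b)) top_form"
  by (rule is_right_edge_top_form) (simp add: ev_J)

text \<open>
  The arithmetic-geometric mean inequality splits the cross term of an arc into a share
  \<open>w e\<close> at its tail and a share \<open>w (rev e)\<close> at its head. After reversing the arcs of the second
  kind, each vertex carries exactly the weights of its outgoing arcs.
\<close>

lemma top_form_le_of_arc_weights:
  assumes w: "\<And>e. e \<in> arcs T \<Longrightarrow> 0 \<le> w e"
    and prod: "\<And>e. e \<in> arcs T \<Longrightarrow> (a e)\<^sup>2 \<le> w e * w (rev e)"
    and l: "\<And>u. u \<in> verts T \<Longrightarrow> b u + (\<Sum>e\<in>out_arcs T u. w e) \<le> l"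
  shows "top_form \<le> l"
proof (rule top_form_le)
  fix \<xi> assume \<xi>: "\<xi> \<in> supp_in (verts T)"
  have M: "(\<Sum>e\<in>out_arcs T u. w e) \<le> l + K" if "u \<in> verts T" for u
    using l[OF that] b_bound[OF that] by linarith
  note W = arcs_weighted_tail[OF w M, of \<xi>]
  let ?t = "\<lambda>e. w e * (cmod (ev \<xi> (tail T e)))\<^sup>2" and ?h = "\<lambda>e. w (rev e) * (cmod (ev \<xi> (head T e)))\<^sup>2"
  have sm: "(\<lambda>e. (1 / 2) * (?t e + ?h e)) summable_on arcs T"
    using W(1,2) by (intro summable_on_cmult_right summable_on_add)
  have arc: "a e * (ev \<xi> (head T e) \<bullet> ev \<xi> (tail T e)) \<le> (1 / 2) * (?t e + ?h e)" if e: "e \<in> arcs T" for e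
  proof -
    let ?x = "cmod (ev \<xi> (tail T e))" and ?y = "cmod (ev \<xi> (head T e))"
    have "a e * (ev \<xi> (head T e) \<bullet> ev \<xi> (tail T e)) \<le> \<bar>a e\<bar> * \<bar>ev \<xi> (head T e) \<bullet> ev \<xi> (tail T e)\<bar>"
      by (simp only: abs_ge_self flip: abs_mult)
    also have "\<dots> \<le> \<bar>a e\<bar> * (?y * ?x)"
      by (intro mult_left_mono Cauchy_Schwarz_ineq2 abs_ge_zero)
    also have "\<dots> \<le> (sqrt (w e) * sqrt (w (rev e))) * (?y * ?x)"
      using prod[OF e] real_sqrt_le_mono[of "(a e)\<^sup>2" "w e * w (rev e)"]
      by (intro mult_right_mono) (auto simp: real_sqrt_mult)
    also have "\<dots> = (sqrt (w e) * ?x) * (sqrt (w (rev e)) * ?y)" by simp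
    also have "\<dots> \<le> ((sqrt (w e) * ?x)\<^sup>2 + (sqrt (w (rev e)) * ?y)\<^sup>2) / 2"
      using sum_squares_bound[of "sqrt (w e) * ?x" "sqrt (w (rev e)) * ?y"] by simp
    also have "\<dots> = (1 / 2) * (?t e + ?h e)"
      using w[OF e] w[of "rev e"] e by (simp add: power_mult_distrib)
    finally show ?thesis .
  qed
  have "(\<Sum>\<^sub>\<infinity>e\<in>arcs T. a e * (ev \<xi> (head T e) \<bullet> ev \<xi> (tail T e))) \<le> (\<Sum>\<^sub>\<infinity>e\<in>arcs T. (1 / 2) * (?t e + ?h e))"
    by (intro infsum_mono summable_arc_form sm arc)
  also have "\<dots> = (1 / 2) * ((\<Sum>\<^sub>\<infinity>e\<in>arcs T. ?t e) + (\<Sum>\<^sub>\<infinity>e\<in>arcs T. ?h e))"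
    using W(1,2) by (simp only: infsum_cmult_right' infsum_add)
  also have "\<dots> = (\<Sum>\<^sub>\<infinity>u\<in>verts T. (\<Sum>e\<in>out_arcs T u. w e) * (cmod (ev \<xi> u))\<^sup>2)"
    using W(3,4) by simp
  finally have arcs_le: "(\<Sum>\<^sub>\<infinity>e\<in>arcs T. a e * (ev \<xi> (head T e) \<bullet> ev \<xi> (tail T e)))
    \<le> (\<Sum>\<^sub>\<infinity>u\<in>verts T. (\<Sum>e\<in>out_arcs T u. w e) * (cmod (ev \<xi> u))\<^sup>2)" .
  have sb: "(\<lambda>u. b u * (cmod (ev \<xi> u))\<^sup>2) summable_on verts T"
    using summable_vertex_form[of \<xi> \<xi>] by (simp add: power2_norm_eq_inner)
  have "J \<xi> \<bullet> \<xi> \<le> (\<Sum>\<^sub>\<infinity>u\<in>verts T. b u * (cmod (ev \<xi> u))\<^sup>2)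
      + (\<Sum>\<^sub>\<infinity>u\<in>verts T. (\<Sum>e\<in>out_arcs T u. w e) * (cmod (ev \<xi> u))\<^sup>2)"
    using arcs_le by (simp add: J_form power2_norm_eq_inner)
  also have "\<dots> = (\<Sum>\<^sub>\<infinity>u\<in>verts T. b u * (cmod (ev \<xi> u))\<^sup>2 + (\<Sum>e\<in>out_arcs T u. w e) * (cmod (ev \<xi> u))\<^sup>2)"
    by (rule infsum_add[OF sb W(5), symmetric])
  also have "\<dots> \<le> (\<Sum>\<^sub>\<infinity>u\<in>verts T. l * (cmod (ev \<xi> u))\<^sup>2)"
  proof (intro infsum_mono summable_on_add sb W(5) summable_on_cmult_right summable_verts)
    fix u assume "u \<in> verts T"
    then show "b u * (cmod (ev \<xi> u))\<^sup>2 + (\<Sum>e\<in>out_arcs T u. w e) * (cmod (ev \<xi> u))\<^sup>2 \<le> l * (cmod (ev \<xi> u))\<^sup>2"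
      using mult_right_mono[OF l, of u "(cmod (ev \<xi> u))\<^sup>2"] by (simp add: distrib_right)
  qed
  also have "\<dots> = l * (norm \<xi>)\<^sup>2"
    by (simp add: infsum_cmult_right' ev_supp_in(3)[OF \<xi>])
  finally show "J \<xi> \<bullet> \<xi> \<le> l * (norm \<xi>)\<^sup>2" .
qed

text \<open>
  The right-hand side for the resolvent equation of the next lemma: square summability is achieved
  by geometric decay along an enumeration of the vertices.
\<close>

lemma positive_l2_vector_exists:
  assumes "countable (verts T)" and s: "\<And>u. u \<in> verts T \<Longrightarrow> \<bar>s u\<bar> = (1::real)"
  shows "\<exists>\<eta>\<in>supp_in (verts T). \<exists>h. \<forall>u\<in>verts T. 0 < h u \<and> ev \<eta> u = complex_of_real (s u * h u)"
proof -
  define h :: "'v \<Rightarrow> real" where "h u = (1 / 2) ^ to_nat_on (verts T) u" for u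
  define f where "f u = (if u \<in> verts T then complex_of_real (s u * h u) else 0)" for u
  have "(\<lambda>k. (1 / 4 :: real) ^ k) summable_on UNIV"
    by (rule norm_summable_imp_summable_on) (simp add: norm_power summable_geometric)
  then have "(\<lambda>k. (1 / 4 :: real) ^ k) summable_on to_nat_on (verts T) ` verts T"
    by (rule summable_on_subset) simp
  then have "(\<lambda>u. (1 / 4 :: real) ^ to_nat_on (verts T) u) summable_on verts T"
    unfolding summable_on_reindex[OF inj_on_to_nat_on[OF assms(1)]] by (simp only: o_def)
  also have "(\<lambda>u. (1 / 4 :: real) ^ to_nat_on (verts T) u) summable_on verts T \<longleftrightarrow>
      (\<lambda>u. (cmod (f u))\<^sup>2) summable_on UNIV"
  proof (rule summable_on_cong_neutral)
    fix u assume "u \<in> verts T \<inter> UNIV"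
    then have "(cmod (f u))\<^sup>2 = (h u)\<^sup>2"
      using s[of u] power2_abs[of "s u"] by (simp add: f_def norm_mult power_mult_distrib del: of_real_mult)
    also have "\<dots> = ((1 / 2)\<^sup>2) ^ to_nat_on (verts T) u"
      unfolding h_def by (simp only: flip: power_mult) (simp only: mult.commute)
    finally show "(1 / 4) ^ to_nat_on (verts T) u = (cmod (f u))\<^sup>2"
      by (simp add: power2_eq_square)
  qed (auto simp: f_def)
  finally have "ev (l2_of f) = f" by (simp add: l2_of_inverse)
  then show ?thesis
    by (intro bexI[of _ "l2_of f"] exI[of _ h]) (auto simp: supp_in_def f_def h_def)
qed

text \<open>
  The signs \<open>s\<close> conjugate the Jacobi matrix to the one with weights \<open>\<bar>a e\<bar>\<close>. In these coordinates
  the map \<open>\<xi> \<mapsto> \<xi> - t (l \<xi> - J \<xi>) + t \<eta>\<close> with small \<open>t\<close> and positive \<open>\<eta>\<close> has nonnegative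
  coefficients, so the solution of \<open>l \<xi> - J \<xi> = \<eta>\<close> is nonnegative; the equation at a single vertex then
  makes it strictly positive there, because \<open>\<eta>\<close> is.
\<close>

lemma positive_supersolution:
  assumes "countable (verts T)"
    and s: "\<And>u. u \<in> verts T \<Longrightarrow> \<bar>s u\<bar> = 1"
    and gauge: "\<And>e. e \<in> arcs T \<Longrightarrow> s (tail T e) * s (head T e) * a e = \<bar>a e\<bar>"
    and l: "top_form < l"
  shows "\<exists>\<phi>. \<forall>u\<in>verts T. 0 < \<phi> u \<and>
    b u * \<phi> u + (\<Sum>e\<in>out_arcs T u. \<bar>a e\<bar> * \<phi> (head T e)) \<le> l * \<phi> u"
proof -
  have s2: "s u * s u = 1" if "u \<in> verts T" for u
    using s[OF that] abs_mult_self_eq[of "s u"] by simp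
  have gauge': "s u * (a e * x) = \<bar>a e\<bar> * (s (head T e) * x)" if "e \<in> out_arcs T u" for u e and x :: real
  proof -
    have e: "e \<in> arcs T" "tail T e = u" "head T e \<in> verts T" using that by auto
    have "s u * (a e * x) = (s (head T e) * s (head T e)) * (s u * (a e * x))"
      by (simp only: s2[OF e(3)] mult_1)
    also have "\<dots> = (s (tail T e) * s (head T e) * a e) * (s (head T e) * x)"
      by (simp only: e(2) mult_ac)
    finally show ?thesis by (simp only: gauge[OF e(1)])
  qed
  obtain \<eta> h where \<eta>: "\<eta> \<in> supp_in (verts T)"
    and h: "\<And>u. u \<in> verts T \<Longrightarrow> 0 < h u" "\<And>u. u \<in> verts T \<Longrightarrow> ev \<eta> u = complex_of_real (s u * h u)"
    using positive_l2_vector_exists[OF assms(1), of s] s by blast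
  define B where "B = (\<lambda>\<xi>. l *\<^sub>R \<xi> - J \<xi>)"
  define cone where
    "cone = supp_in (verts T) \<inter> (\<Inter>u\<in>verts T. {\<xi>. Im (ev \<xi> u) = 0} \<inter> {\<xi>. 0 \<le> s u * Re (ev \<xi> u)})"
  have Im_J: "Im (ev (J \<xi>) u) = b u * Im (ev \<xi> u) + (\<Sum>e\<in>out_arcs T u. a e * Im (ev \<xi> (head T e)))"
    and Re_J: "Re (ev (J \<xi>) u) = b u * Re (ev \<xi> u) + (\<Sum>e\<in>out_arcs T u. a e * Re (ev \<xi> (head T e)))"
    if "u \<in> verts T" for \<xi> u
    using that by (auto simp: ev_J jacobi_matrix_def)
  have s_Re_J: "s u * Re (ev (J \<xi>) u) =
      b u * (s u * Re (ev \<xi> u)) + (\<Sum>e\<in>out_arcs T u. \<bar>a e\<bar> * (s (head T e) * Re (ev \<xi> (head T e))))"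
    if "u \<in> verts T" for \<xi> u
  proof -
    have "(\<Sum>e\<in>out_arcs T u. s u * (a e * Re (ev \<xi> (head T e)))) =
        (\<Sum>e\<in>out_arcs T u. \<bar>a e\<bar> * (s (head T e) * Re (ev \<xi> (head T e))))"
      by (intro sum.cong refl gauge')
    then show ?thesis
      by (simp only: Re_J[OF that] distrib_left sum_distrib_left mult.left_commute[of "s u" "b u"])
  qed
  \<comment> \<open>The step size keeps the diagonal coefficients \<open>1 - t l + t b u\<close> of the iteration nonnegative.\<close>
  have "\<exists>\<xi>\<in>cone. B \<xi> = \<eta>"
  proof (rule coercive_solution_in[where S = "supp_in (verts T)" and c = "l - top_form" and s = "1 / (\<bar>l\<bar> + K + 1)"])
    show "bounded_linear B"
      unfolding B_def by (intro bounded_linear_sub bounded_linear_scaleR_right bounded_linear_J)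
    show "(l - top_form) * (norm \<xi>)\<^sup>2 \<le> B \<xi> \<bullet> \<xi>" if "\<xi> \<in> supp_in (verts T)" for \<xi>
      using form_coercive[OF that] by (simp add: B_def)
    have cont: "continuous_on UNIV (\<lambda>\<xi>. ev \<xi> u)" for u :: 'v
      by (rule bounded_linear.continuous_on[OF bounded_linear_ev]) (rule continuous_on_id)
    show "closed cone"
      unfolding cone_def
      by (intro closed_Int closed_INT ballI closed_supp_in closed_Collect_eq closed_Collect_le
          continuous_intros cont)
    show "cone \<noteq> {}"
      using subspace_0[OF subspace_supp_in, of "verts T"] by (auto simp: cone_def intro!: exI[of _ 0])
    show "0 < 1 / (\<bar>l\<bar> + K + 1)" using K_nonneg by (simp add: add_nonneg_pos)
    fix t :: real and \<xi> :: "'v l2"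
    assume t: "0 < t" "t \<le> 1 / (\<bar>l\<bar> + K + 1)" and \<xi>: "\<xi> \<in> cone"
    let ?\<xi>' = "\<xi> - t *\<^sub>R B \<xi> + t *\<^sub>R \<eta>"
    have supp: "\<xi> \<in> supp_in (verts T)" using \<xi> by (auto simp: cone_def)
    have "?\<xi>' \<in> supp_in (verts T)"
      unfolding B_def using supp \<eta> A_supp[OF supp]
      by (intro subspace_add subspace_diff subspace_scale subspace_supp_in)
    moreover have "Im (ev ?\<xi>' u) = 0" if "u \<in> verts T" for u
    proof -
      have "Im (ev (J \<xi>) u) = 0"
        unfolding Im_J[OF that] using \<xi> that by (auto simp: cone_def intro!: sum.neutral)
      then show ?thesis using \<xi> that h(2)[OF that] by (auto simp: cone_def B_def)
    qed
    moreover have "0 \<le> s u * Re (ev ?\<xi>' u)" if u: "u \<in> verts T" for u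
    proof -
      let ?x = "\<lambda>v. s v * Re (ev \<xi> v)"
      have x: "0 \<le> ?x v" if "v \<in> verts T" for v using that \<xi> by (auto simp: cone_def)
      have "t * (l - b u) \<le> t * (\<bar>l\<bar> + K + 1)"
        using t b_bound[OF u] by (intro mult_left_mono) auto
      also have "\<dots> \<le> 1" using t K_nonneg by (simp add: field_simps)
      finally have diag: "0 \<le> 1 - t * l + t * b u" by (simp add: algebra_simps)
      have "s u * Re (ev ?\<xi>' u) = ?x u - t * (l * ?x u - s u * Re (ev (J \<xi>) u)) + t * ((s u * s u) * h u)"
        using h(2)[OF u] by (simp add: B_def algebra_simps)
      also have "\<dots> = (1 - t * l + t * b u) * ?x u + t * (\<Sum>e\<in>out_arcs T u. \<bar>a e\<bar> * ?x (head T e)) + t * h u"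
        unfolding s_Re_J[OF u] s2[OF u] by (simp add: algebra_simps)
      also have "\<dots> \<ge> 0"
        using t h(1)[OF u]
        by (intro add_nonneg_nonneg mult_nonneg_nonneg[OF diag x[OF u]] mult_nonneg_nonneg[OF _ sum_nonneg]
            mult_nonneg_nonneg[OF abs_ge_zero x]) auto
      finally show ?thesis .
    qed
    ultimately show "?\<xi>' \<in> cone" by (auto simp: cone_def)
  qed (use l in \<open>auto simp: subspace_supp_in cone_def\<close>)
  then obtain \<xi> where \<xi>: "\<xi> \<in> cone" "l *\<^sub>R \<xi> - J \<xi> = \<eta>" by (auto simp: B_def)
  define \<phi> where "\<phi> u = s u * Re (ev \<xi> u)" for u
  have nonneg: "0 \<le> \<phi> u" if "u \<in> verts T" for u using that \<xi>(1) by (auto simp: cone_def \<phi>_def)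
  have eq: "l * \<phi> u = b u * \<phi> u + (\<Sum>e\<in>out_arcs T u. \<bar>a e\<bar> * \<phi> (head T e)) + h u" if u: "u \<in> verts T" for u
  proof -
    have "ev (l *\<^sub>R \<xi> - J \<xi>) u = complex_of_real (s u * h u)" unfolding \<xi>(2) by (rule h(2)[OF u])
    then have "l * Re (ev \<xi> u) - Re (ev (J \<xi>) u) = s u * h u"
      by (simp add: complex_eq_iff)
    then have "l * \<phi> u - s u * Re (ev (J \<xi>) u) = (s u * s u) * h u"
      unfolding \<phi>_def by (metis (no_types, opaque_lifting) mult.assoc mult.left_commute right_diff_distrib')
    then show ?thesis unfolding s_Re_J[OF u] s2[OF u] \<phi>_def by simp
  qed
  have "0 < \<phi> u" if u: "u \<in> verts T" for u
  proof -
    have "0 \<le> (\<Sum>e\<in>out_arcs T u. \<bar>a e\<bar> * \<phi> (head T e))"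
      by (intro sum_nonneg mult_nonneg_nonneg nonneg) auto
    then have "0 < (l - b u) * \<phi> u" using eq[OF u] h(1)[OF u] by (simp add: left_diff_distrib)
    then show ?thesis using nonneg[OF u] by (cases "\<phi> u = 0") auto
  qed
  moreover have "b u * \<phi> u + (\<Sum>e\<in>out_arcs T u. \<bar>a e\<bar> * \<phi> (head T e)) \<le> l * \<phi> u" if "u \<in> verts T" for u
    using eq[OF that] h(1)[OF that] by linarith
  ultimately show ?thesis by blast
qed

end

section \<open>The universal cover as a bounded-degree graph\<close>

locale weighted_graph = fin_digraph G + bidirected_digraph G arev
  for G :: "('v, 'e) pre_digraph" and arev :: "'e \<Rightarrow> 'e" +
  fixes a :: "'e \<Rightarrow> real" and b :: "'v \<Rightarrow> real" and v0 :: 'v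
  assumes weight_arev: "f \<in> arcs G \<Longrightarrow> a (arev f) = a f"
    and connected_G: "Digraph_Component.connected G"
    and base_in_verts: "v0 \<in> verts G"
begin

abbreviation "W \<equiv> nb_walks G arev v0"
abbreviation "end_of \<equiv> cover_map G v0"
abbreviation "T \<equiv> universal_cover G arev v0"

text \<open>
  The reduced form of the walk \<open>w\<close> followed by \<open>f\<close>. In this way the arcs at the end of \<open>w\<close> label
  the neighbours of \<open>w\<close> in the tree, with no special role for the neighbour closer to the root.
\<close>

definition nbr :: "'e list \<Rightarrow> 'e \<Rightarrow> 'e list" where
  "nbr w f = (if w \<noteq> [] \<and> f = arev (last w) then butlast w else w @ [f])"

lemma Nil_in_W: "[] \<in> W"
  using base_in_verts by (auto simp: nb_walks_def awalk_Nil_iff)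

lemma end_Nil [simp]: "end_of [] = v0"
  by (simp add: cover_map_def)

lemma end_snoc [simp]: "end_of (w @ [f]) = head G f"
  by (simp add: cover_map_def awalk_verts_conv)

lemma W_snoc_iff:
  "w @ [f] \<in> W \<longleftrightarrow> w \<in> W \<and> f \<in> out_arcs G (end_of w) \<and> (w \<noteq> [] \<longrightarrow> f \<noteq> arev (last w))"
  by (auto simp: nb_walks_def cover_map_def successively_append_iff awalk_simps)

lemma W_cases:
  assumes "w \<in> W"
  obtains "w = []" | w' g where "w = w' @ [g]" "w' \<in> W" "g \<in> out_arcs G (end_of w')"
  using assms by (cases w rule: rev_cases) (auto simp: W_snoc_iff)

lemma end_in_verts: "w \<in> W \<Longrightarrow> end_of w \<in> verts G"
  by (erule W_cases) (use base_in_verts in auto)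

lemma nbr_in_W:
  assumes "w \<in> W" "f \<in> out_arcs G (end_of w)"
  shows "nbr w f \<in> W" and "end_of (nbr w f) = head G f"
proof -
  have "nbr w f \<in> W \<and> end_of (nbr w f) = head G f"
  proof (cases "w \<noteq> [] \<and> f = arev (last w)")
    case True
    from assms(1) show ?thesis by (rule W_cases) (use True in \<open>auto simp: nbr_def\<close>)
  next
    case False
    then have "nbr w f = w @ [f]" by (auto simp: nbr_def)
    then show ?thesis using assms False by (simp only: W_snoc_iff end_snoc) blast
  qed
  then show "nbr w f \<in> W" and "end_of (nbr w f) = head G f" by auto
qed

lemma nbr_arev:
  assumes "w \<in> W" "f \<in> out_arcs G (end_of w)"
  shows "nbr (nbr w f) (arev f) = w"
  using assms(1)
proof (cases rule: W_cases)
  case 1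
  then show ?thesis by (simp add: nbr_def)
next
  case (2 w' g)
  show ?thesis
  proof (cases "f = arev g")
    case True
    have "w' \<noteq> [] \<longrightarrow> g \<noteq> arev (last w')" using assms(1) 2 by (simp add: W_snoc_iff)
    then show ?thesis using True 2 by (auto simp: nbr_def)
  qed (simp add: 2 nbr_def butlast_append)
qed

lemma verts_T [simp]: "verts T = W" and tail_T [simp]: "tail T = fst" and head_T [simp]: "head T = snd"
  by (simp_all add: universal_cover_def)

lemma inj_on_nbr: "inj_on (\<lambda>f. (w, nbr w f)) (out_arcs G (end_of w))"
proof (rule inj_onI)
  fix f g assume "(w, nbr w f) = (w, nbr w g)"
  then have eq: "nbr w f = nbr w g" by simp
  then have "length (nbr w f) = length (nbr w g)" by simp
  then have "(w \<noteq> [] \<and> f = arev (last w)) = (w \<noteq> [] \<and> g = arev (last w))"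
    unfolding nbr_def by (auto split: if_split_asm)
  then show "f = g" using eq unfolding nbr_def by (auto split: if_split_asm)
qed

lemma out_arcs_T:
  assumes w: "w \<in> W"
  shows "out_arcs T w = (\<lambda>f. (w, nbr w f)) ` out_arcs G (end_of w)"
proof (intro equalityI subsetI)
  fix e assume "e \<in> out_arcs T w"
  then obtain w' where e: "e = (w, w')" "w' \<in> W" "(\<exists>f. w' = w @ [f]) \<or> (\<exists>f. w = w' @ [f])"
    by (auto simp: universal_cover_def)
  from e(3) show "e \<in> (\<lambda>f. (w, nbr w f)) ` out_arcs G (end_of w)"
  proof (elim disjE exE)
    fix f assume f: "w' = w @ [f]"
    then show ?thesis
      using e by (intro image_eqI[of _ _ f]) (auto simp: W_snoc_iff nbr_def)
  next
    fix f assume f: "w = w' @ [f]"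
    then show ?thesis
      using e w by (intro image_eqI[of _ _ "arev f"]) (auto simp: W_snoc_iff nbr_def)
  qed
next
  fix e assume "e \<in> (\<lambda>f. (w, nbr w f)) ` out_arcs G (end_of w)"
  then obtain f where f: "f \<in> out_arcs G (end_of w)" "e = (w, nbr w f)" by blast
  have "(\<exists>g. nbr w f = w @ [g]) \<or> (\<exists>g. w = nbr w f @ [g])"
    by (metis append_butlast_last_id nbr_def)
  then show "e \<in> out_arcs T w"
    using f w nbr_in_W[OF w f(1)] by (auto simp: universal_cover_def)
qed

lemma sum_out_arcs_T:
  assumes "w \<in> W"
  shows "(\<Sum>e\<in>out_arcs T w. F e) = (\<Sum>f\<in>out_arcs G (end_of w). F (w, nbr w f))"
  by (simp add: out_arcs_T[OF assms] sum.reindex[OF inj_on_nbr])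

lemma lift_weight_nbr:
  assumes "w \<in> W" "f \<in> out_arcs G (end_of w)"
  shows "lift_weight a (w, nbr w f) = a f"
proof (cases "w \<noteq> [] \<and> f = arev (last w)")
  case True
  then have "last w \<in> arcs G" using assms(2) by (metis arev_arev arev_in_arcs in_out_arcs_conv)
  then show ?thesis using True by (auto simp: nbr_def lift_weight_def weight_arev)
next
  case False
  then show ?thesis by (auto simp: nbr_def lift_weight_def)
qed

lemma arcs_T_cases:
  assumes "e \<in> arcs T"
  obtains w f where "w \<in> W" "w @ [f] \<in> W" "f \<in> arcs G" "tail G f = end_of w"
      "e = (w, w @ [f]) \<or> e = (w @ [f], w)"
  using assms by (fastforce simp: universal_cover_def W_snoc_iff)

definition T_rev :: "'e list \<times> 'e list \<Rightarrow> 'e list \<times> 'e list" where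
  "T_rev e = (if e \<in> arcs T then (snd e, fst e) else e)"

definition weight_bound :: real where
  "weight_bound = (\<Sum>f\<in>arcs G. \<bar>a f\<bar>) + (\<Sum>v\<in>verts G. \<bar>b v\<bar>)"

lemma bidirected_T: "bidirected_digraph T T_rev"
proof
  fix e
  show "e \<in> arcs T \<Longrightarrow> tail T e \<in> verts T" "e \<in> arcs T \<Longrightarrow> head T e \<in> verts T"
    by (auto simp: universal_cover_def)
  show "(e \<in> arcs T) = (T_rev e \<noteq> e)"
    by (auto simp: universal_cover_def T_rev_def)
  show "T_rev (T_rev e) = e" "tail T (T_rev e) = head T e" if "e \<in> arcs T"
    using that by (auto simp: universal_cover_def T_rev_def)
qed

lemma abs_a_le: "f \<in> arcs G \<Longrightarrow> \<bar>a f\<bar> \<le> weight_bound"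
  unfolding weight_bound_def by (rule add_increasing2) (auto intro: sum_nonneg member_le_sum)

lemma abs_b_le: "v \<in> verts G \<Longrightarrow> \<bar>b v\<bar> \<le> weight_bound"
  unfolding weight_bound_def by (rule add_increasing) (auto intro: sum_nonneg member_le_sum)

sublocale C: bounded_jacobi T T_rev "lift_weight a" "\<lambda>w. b (end_of w)" "card (arcs G)" weight_bound
proof (intro bounded_jacobi.intro bounded_jacobi_axioms.intro bidirected_T)
  fix w
  show "finite (out_arcs T w)"
  proof (cases "w \<in> W")
    case False
    then have "out_arcs T w = {}" by (auto simp: universal_cover_def)
    then show ?thesis by simp
  qed (auto simp: out_arcs_T)
  show "card (out_arcs T w) \<le> card (arcs G)"
  proof (cases "w \<in> W")
    case True
    have "card (out_arcs T w) \<le> card (out_arcs G (end_of w))"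
      unfolding out_arcs_T[OF True] by (rule card_image_le) (rule finite_out_arcs)
    also have "\<dots> \<le> card (arcs G)" by (rule card_mono) auto
    finally show ?thesis .
  next
    case False
    then have "out_arcs T w = {}" by (auto simp: universal_cover_def)
    then show ?thesis by simp
  qed
next
  fix e assume e: "e \<in> arcs T"
  then show "\<bar>lift_weight a e\<bar> \<le> weight_bound"
    by (rule arcs_T_cases) (auto simp: lift_weight_def abs_a_le)
  from e show "lift_weight a (T_rev e) = lift_weight a e"
    by (rule arcs_T_cases) (use e in \<open>auto simp: lift_weight_def T_rev_def\<close>)
next
  show "verts T \<noteq> {}" using Nil_in_W by auto
qed (simp add: abs_b_le end_in_verts)

lemma countable_W: "countable W"
proof (rule countable_subset)
  show "W \<subseteq> lists (arcs G)" by (auto simp: nb_walks_def awalk_def)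
  show "countable (lists (arcs G))" by (intro countable_lists countable_finite) simp
qed

lemma cover_map_surj:
  assumes "i \<in> verts G"
  shows "\<exists>w\<in>W. end_of w = i"
proof -
  have "v0 \<rightarrow>\<^sup>*\<^bsub>G\<^esub> i"
    using symmetric_connected_imp_strongly_connected[OF sym_arcs connected_G] base_in_verts assms
    by (auto simp: strongly_connected_def)
  then show ?thesis
  proof (induction rule: reachable_induct)
    case base
    then show ?case using Nil_in_W by (intro bexI[of _ "[]"]) auto
  next
    case (step x y)
    then obtain w where w: "w \<in> W" "end_of w = x" by blast
    from step obtain f where f: "f \<in> arcs G" "tail G f = x" "head G f = y"
      by (auto simp: arcs_ends_conv)
    then show ?case using nbr_in_W[of w f] w by auto
  qed
qed

text \<open>
  A tree has no cycles, so the sign of an edge weight is the product of signs at its two ends.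
  The sign at a vertex is the product of the signs along the walk from the root.
\<close>

definition gauge :: "'e list \<Rightarrow> real" where
  "gauge w = (\<Prod>f\<leftarrow>w. if a f < 0 then - 1 else 1)"

lemma abs_gauge: "\<bar>gauge w\<bar> = 1"
  by (induction w) (auto simp: gauge_def abs_mult)

lemma gauge_arc:
  assumes "e \<in> arcs T"
  shows "gauge (fst e) * gauge (snd e) * lift_weight a e = \<bar>lift_weight a e\<bar>"
proof -
  have sq: "gauge w * gauge w = 1" for w
    using abs_gauge[of w] abs_mult_self_eq[of "gauge w"] by simp
  obtain w f where e: "e = (w, w @ [f]) \<or> e = (w @ [f], w)"
    using assms by (rule arcs_T_cases)
  have "gauge w * gauge (w @ [f]) * a f = (gauge w * gauge w) * ((if a f < 0 then - 1 else 1) * a f)"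
    by (simp only: gauge_def map_append prod_list.append list.map prod_list.Cons prod_list.Nil mult_1_right mult.assoc)
  also have "\<dots> = \<bar>a f\<bar>" by (simp add: sq)
  finally show ?thesis using e by (auto simp: lift_weight_def mult_ac)
qed

lemma positive_cover_supersolution:
  assumes "C.top_form < l"
  shows "\<exists>\<phi>. \<forall>w\<in>W. 0 < \<phi> w \<and>
    b (end_of w) * \<phi> w + (\<Sum>f\<in>out_arcs G (end_of w). \<bar>a f\<bar> * \<phi> (nbr w f)) \<le> l * \<phi> w"
proof -
  have "(\<Sum>e\<in>out_arcs T w. \<bar>lift_weight a e\<bar> * \<phi> (head T e)) =
      (\<Sum>f\<in>out_arcs G (end_of w). \<bar>a f\<bar> * \<phi> (nbr w f))" if "w \<in> W" for w \<phi>
    unfolding sum_out_arcs_T[OF that] by (intro sum.cong refl) (simp only: lift_weight_nbr[OF that] head_T snd_conv)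
  then show ?thesis
    using C.positive_supersolution[of gauge l] assms countable_W abs_gauge gauge_arc by simp
qed

end

section \<open>Every tuple gives an upper bound\<close>

lemma root_weights_product:
  fixes p q c :: real
  assumes "0 < p" "0 < q"
  defines "s \<equiv> sqrt (1 + 4 * c\<^sup>2 * p * q)"
  shows "((s - 1) / (2 * p)) * ((s + 1) / (2 * q)) = c\<^sup>2" "1 \<le> s"
proof -
  have nn: "0 \<le> 4 * c\<^sup>2 * p * q" using assms by simp
  then have "s\<^sup>2 = 1 + 4 * c\<^sup>2 * p * q" by (simp add: s_def)
  then have "(s - 1) * (s + 1) = c\<^sup>2 * ((2 * p) * (2 * q))"
    by (simp add: power2_eq_square algebra_simps)
  then show "((s - 1) / (2 * p)) * ((s + 1) / (2 * q)) = c\<^sup>2"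
    using assms(1,2) by (simp add: times_divide_times_eq)
  show "1 \<le> s" using nn by (simp add: s_def)
qed

context weighted_graph
begin

text \<open>
  For \<open>f\<close> from \<open>i\<close> to \<open>j\<close> and \<open>s = sqrt (1 + 4 a\<^sub>f\<^sup>2 y\<^sub>i y\<^sub>j)\<close>, an edge of the tree over \<open>f\<close> that
  leads away from the root gets the share \<open>(s - 1) / (2 y\<^sub>i)\<close> at its end near the root and
  \<open>(s + 1) / (2 y\<^sub>j)\<close> at its far end; the product is \<open>a\<^sub>f\<^sup>2\<close>. A vertex over \<open>i\<close> has at most one edge
  towards the root, so its shares sum to at most \<open>(2 - deg i + (\<Sum> s)) / (2 y\<^sub>i)\<close>.
\<close>

lemma top_form_le_edge_expr:
  assumes y: "\<And>i. i \<in> verts G \<Longrightarrow> 0 < y i"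
    and l: "\<And>i. i \<in> verts G \<Longrightarrow> edge_expr G a b y i \<le> l"
  shows "C.top_form \<le> l"
proof -
  define S where "S f = sqrt (1 + 4 * (a f)\<^sup>2 * y (tail G f) * y (head G f))" for f
  define down where "down f = (S f - 1) / (2 * y (tail G f))" for f
  define up where "up f = (S f + 1) / (2 * y (head G f))" for f
  define wt where "wt e = (if length (fst e) < length (snd e) then down (last (snd e)) else up (last (fst e)))" for e
  have prod: "down f * up f = (a f)\<^sup>2" and S1: "1 \<le> S f" if "f \<in> arcs G" for f
    using root_weights_product[of "y (tail G f)" "y (head G f)" "a f"] y that
    by (simp_all add: down_def up_def S_def)
  have S_arev: "S (arev f) = S f" if "f \<in> arcs G" for f
    using that by (simp add: S_def weight_arev mult_ac)
  have nonneg: "0 \<le> down f" "0 \<le> up f" if "f \<in> arcs G" for f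
    using S1[OF that] y that by (auto simp: down_def up_def intro!: divide_nonneg_pos)
  show ?thesis
  proof (rule C.top_form_le_of_arc_weights[where w = wt])
    fix e assume e: "e \<in> arcs T"
    then show "0 \<le> wt e"
      by (rule arcs_T_cases) (auto simp: wt_def nonneg)
    from e show "(lift_weight a e)\<^sup>2 \<le> wt e * wt (T_rev e)"
    proof (rule arcs_T_cases)
      fix w f assume f: "f \<in> arcs G" "e = (w, w @ [f]) \<or> e = (w @ [f], w)"
      have "wt e * wt (T_rev e) = down f * up f"
        using f(2) e by (auto simp: wt_def T_rev_def)
      moreover have "lift_weight a e = a f" using f(2) by (auto simp: lift_weight_def)
      ultimately show ?thesis using prod[OF f(1)] by simp
    qed
  next
    fix w assume "w \<in> verts T"
    then have w: "w \<in> W" by simp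
    define i where "i = end_of w"
    have i: "i \<in> verts G" using end_in_verts[OF w] by (simp add: i_def)
    have yi: "0 < y i" using y[OF i] .
    have wt_nbr: "wt (w, nbr w f) = down f + (if w \<noteq> [] \<and> f = arev (last w) then 1 / y i else 0)"
      if f: "f \<in> out_arcs G i" for f
    proof (cases "w \<noteq> [] \<and> f = arev (last w)")
      case True
      then have lw: "last w = arev f" by simp
      have "wt (w, nbr w f) = up (arev f)"
        using True by (auto simp: wt_def nbr_def lw)
      also have "\<dots> = down f + 1 / y i"
        using f S_arev yi by (simp add: up_def down_def field_simps)
      finally show ?thesis using True by simp
    qed (auto simp: wt_def nbr_def)
    have "(\<Sum>e\<in>out_arcs T w. wt e) = (\<Sum>f\<in>out_arcs G i. wt (w, nbr w f))"
      unfolding sum_out_arcs_T[OF w] i_def ..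
    also have "\<dots> = (\<Sum>f\<in>out_arcs G i. down f) + (\<Sum>f\<in>out_arcs G i. if w \<noteq> [] \<and> f = arev (last w) then 1 / y i else 0)"
      by (simp add: wt_nbr sum.distrib)
    also have "(\<Sum>f\<in>out_arcs G i. if w \<noteq> [] \<and> f = arev (last w) then 1 / y i else 0) \<le> 1 / y i"
    proof (cases "w = []")
      case False
      have "(\<Sum>f\<in>out_arcs G i. if f = arev (last w) then 1 / y i else 0) \<le> 1 / y i"
        using yi by (subst sum.delta) (auto simp: finite_out_arcs)
      then show ?thesis using False by simp
    qed (use yi in simp)
    also have "(\<Sum>f\<in>out_arcs G i. down f) = ((\<Sum>f\<in>out_arcs G i. S f) - real (out_degree G i)) / (2 * y i)"
      by (simp add: down_def sum_subtractf out_degree_def flip: sum_divide_distrib)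
    finally have "b i + (\<Sum>e\<in>out_arcs T w. wt e) \<le> edge_expr G a b y i"
      using yi by (simp add: edge_expr_def S_def field_simps)
    then show "b (end_of w) + (\<Sum>e\<in>out_arcs T w. wt e) \<le> l"
      using l[OF i] by (simp add: i_def)
  qed
qed

section \<open>Equalising tuples just above the right edge\<close>

text \<open>
  The arcs by which a non-backtracking walk can continue after \<open>f\<close>.
\<close>

definition beyond :: "'e \<Rightarrow> 'e set" where
  "beyond f = out_arcs G (head G f) - {arev f}"

text \<open>
  For \<open>l\<close> above the spectrum, \<open>a\<^sub>f\<^sup>2\<close> times the diagonal Green function of the branch of the tree
  beyond \<open>f\<close>, at the first vertex of the branch, solves these equations: they express the Green
  function of a branch through those of its subbranches. The iteration from \<open>0\<close> corresponds to
  truncating the branch at finite depth. It increases, and the supersolution \<open>S\<close> bounds it and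
  keeps the denominators positive.
\<close>

lemma beyond_fixed_point:
  assumes S0: "\<And>f. f \<in> arcs G \<Longrightarrow> 0 \<le> S f"
    and S: "\<And>f. f \<in> arcs G \<Longrightarrow> (a f)\<^sup>2 \<le> S f * (l - b (head G f) - (\<Sum>g\<in>beyond f. S g))"
    and pos: "\<And>f. f \<in> arcs G \<Longrightarrow> 0 < l - b (head G f) - (\<Sum>g\<in>beyond f. S g)"
  shows "\<exists>t. \<forall>f\<in>arcs G. 0 \<le> t f \<and> t f \<le> S f \<and>
    t f * (l - b (head G f) - (\<Sum>g\<in>beyond f. t g)) = (a f)\<^sup>2"
proof -
  define D where "D t f = l - b (head G f) - (\<Sum>g\<in>beyond f. t g)" for t :: "'e \<Rightarrow> real" and f
  define \<Phi> where "\<Phi> t f = (a f)\<^sup>2 / D t f" for t f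
  define t where "t k = (\<Phi> ^^ k) (\<lambda>_. 0)" for k
  have t_Suc: "t (Suc k) = \<Phi> (t k)" and t_0: "t 0 = (\<lambda>_. 0)" for k by (simp_all add: t_def)
  have beyond_arcs: "g \<in> beyond f \<Longrightarrow> g \<in> arcs G" for f g by (simp add: beyond_def)
  have D_anti: "D t' f \<le> D t f" if "\<And>g. g \<in> arcs G \<Longrightarrow> t g \<le> t' g" for t t' f
    unfolding D_def by (intro diff_left_mono sum_mono that beyond_arcs)
  have DS: "0 < D S f" "(a f)\<^sup>2 / D S f \<le> S f" if "f \<in> arcs G" for f
    using S[OF that] pos[OF that] by (simp_all add: D_def field_simps)
  have bound: "0 \<le> t k f \<and> t k f \<le> S f" if "f \<in> arcs G" for k f
    using that
  proof (induction k arbitrary: f)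
    case (Suc k)
    have le: "D S f \<le> D (t k) f" by (rule D_anti) (use Suc.IH in simp)
    then have "(a f)\<^sup>2 / D (t k) f \<le> (a f)\<^sup>2 / D S f"
      using DS(1)[OF Suc.prems] by (intro divide_left_mono mult_pos_pos) auto
    then show ?case using DS[OF Suc.prems] le by (auto simp: t_Suc \<Phi>_def intro: order_trans)
  qed (simp add: t_0 S0)
  have D_pos: "0 < D (t k) f" if "f \<in> arcs G" for k f
    using DS(1)[OF that] D_anti[of "t k" S f] bound by (meson less_le_trans)
  have mono: "t k f \<le> t (Suc k) f" if "f \<in> arcs G" for k f
    using that
  proof (induction k arbitrary: f)
    case 0
    then show ?case using bound[of f "Suc 0"] by (simp add: t_0)
  next
    case (Suc k)
    have "D (t (Suc k)) f \<le> D (t k) f" by (rule D_anti) (rule Suc.IH)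
    then have "(a f)\<^sup>2 / D (t k) f \<le> (a f)\<^sup>2 / D (t (Suc k)) f"
      using D_pos[OF Suc.prems] by (intro divide_left_mono mult_pos_pos) auto
    then show ?case by (simp only: t_Suc[of "Suc k"] t_Suc[of k] \<Phi>_def)
  qed
  have "\<exists>x. (\<lambda>k. t k f) \<longlonglongrightarrow> x" if f: "f \<in> arcs G" for f
  proof -
    have "incseq (\<lambda>k. t k f)" by (rule incseq_SucI) (rule mono[OF f])
    then show ?thesis by (rule incseq_convergent[of _ "S f"]) (use bound[OF f] in auto)
  qed
  then obtain L where L: "\<And>f. f \<in> arcs G \<Longrightarrow> (\<lambda>k. t k f) \<longlonglongrightarrow> L f"
    by metis
  have L_bound: "0 \<le> L f \<and> L f \<le> S f" if "f \<in> arcs G" for f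
    using bound[OF that] by (intro conjI LIMSEQ_le_const[OF L[OF that]] LIMSEQ_le_const2[OF L[OF that]]) auto
  have "L f * D L f = (a f)\<^sup>2" if f: "f \<in> arcs G" for f
  proof -
    have "(\<lambda>k. t (Suc k) f * D (t k) f) \<longlonglongrightarrow> L f * D L f"
      unfolding D_def by (intro tendsto_intros LIMSEQ_Suc L f beyond_arcs)
    moreover have "t (Suc k) f * D (t k) f = (a f)\<^sup>2" for k
      using D_pos[OF f, of k] by (simp add: t_Suc \<Phi>_def)
    ultimately show ?thesis by (simp add: LIMSEQ_const_iff)
  qed
  then show ?thesis using L_bound unfolding D_def by blast
qed

lemma sum_out_split_arev:
  assumes "f \<in> arcs G"
  shows "(\<Sum>g\<in>out_arcs G (head G f). F g) = F (arev f) + (\<Sum>g\<in>beyond f. F g)"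
  unfolding beyond_def using assms by (intro sum.remove) auto

text \<open>
  If \<open>t\<close> comes from the Green functions of the branches, then \<open>y i\<close> is the diagonal Green function of
  the whole tree at a vertex over \<open>i\<close>. For \<open>f\<close> from \<open>i\<close> to \<open>j\<close>, the equations for
  \<open>f\<close> and its reversal imply that \<open>t f / y j\<close> equals \<open>t (arev f) / y i\<close>. Eliminating
  \<open>t (arev f)\<close> leaves a quadratic equation for \<open>t f\<close>, whose nonnegative solution is
  \<open>2 y i t f = sqrt (1 + 4 a\<^sub>f\<^sup>2 y i y j) - 1\<close>. Summing over the arcs at \<open>i\<close> recovers \<open>l\<close>.
\<close>

lemma edge_expr_of_fixed_point:
  assumes t: "\<And>f. f \<in> arcs G \<Longrightarrow> 0 \<le> t f"
    and rec: "\<And>f. f \<in> arcs G \<Longrightarrow> t f * (l - b (head G f) - (\<Sum>g\<in>beyond f. t g)) = (a f)\<^sup>2"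
    and pos: "\<And>i. i \<in> verts G \<Longrightarrow> 0 < l - b i - (\<Sum>g\<in>out_arcs G i. t g)"
  defines "y \<equiv> \<lambda>i. 1 / (l - b i - (\<Sum>g\<in>out_arcs G i. t g))"
  assumes i: "i \<in> verts G"
  shows "0 < y i" "edge_expr G a b y i = l"
proof -
  have y: "0 < y i" if "i \<in> verts G" for i using pos[OF that] by (simp add: y_def)
  then show "0 < y i" using i .
  have inv_y: "1 / y i = l - b i - (\<Sum>g\<in>out_arcs G i. t g)" for i by (simp add: y_def)
  have t_eq: "t f * (1 / y (head G f) + t (arev f)) = (a f)\<^sup>2" if "f \<in> arcs G" for f
    using rec[OF that] unfolding inv_y sum_out_split_arev[OF that] by (simp add: algebra_simps)
  have sqrt_eq: "sqrt (1 + 4 * (a f)\<^sup>2 * y (tail G f) * y (head G f)) = 1 + 2 * y (tail G f) * t f"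
    if f: "f \<in> arcs G" for f
  proof -
    let ?p = "y (tail G f)" and ?q = "y (head G f)"
    have pq: "0 < ?p" "0 < ?q" using y f by auto
    have e1: "t f * (1 / ?q + t (arev f)) = (a f)\<^sup>2" by (rule t_eq[OF f])
    have e2: "t (arev f) * (1 / ?p + t f) = (a f)\<^sup>2"
      using t_eq[of "arev f"] f by (simp add: weight_arev)
    have "t f / ?q = t (arev f) / ?p" using e1 e2 by (simp add: algebra_simps)
    then have "t (arev f) = t f * ?p / ?q" using pq by (simp add: field_simps)
    then have "(a f)\<^sup>2 * ?q = t f + (t f)\<^sup>2 * ?p"
      using e1 pq by (simp add: field_simps power2_eq_square)
    then have "1 + 4 * (a f)\<^sup>2 * ?p * ?q = 1 + 4 * ?p * (t f + (t f)\<^sup>2 * ?p)"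
      by (simp add: mult_ac)
    also have "\<dots> = (1 + 2 * ?p * t f)\<^sup>2" by (simp add: power2_eq_square algebra_simps)
    finally show ?thesis using pq t[OF f] by (simp add: real_sqrt_unique)
  qed
  have "(\<Sum>f\<in>out_arcs G i. sqrt (1 + 4 * (a f)\<^sup>2 * y (tail G f) * y (head G f)))
      = (\<Sum>f\<in>out_arcs G i. 1 + 2 * y i * t f)"
    by (intro sum.cong refl) (auto simp: sqrt_eq)
  also have "\<dots> = real (out_degree G i) + 2 * y i * (\<Sum>f\<in>out_arcs G i. t f)"
    by (simp add: sum.distrib out_degree_def sum_distrib_left)
  also have "(\<Sum>f\<in>out_arcs G i. t f) = l - b i - 1 / y i" using inv_y[of i] by simp
  finally show "edge_expr G a b y i = l"
    using y[OF i] by (simp only: edge_expr_def) (simp add: field_simps)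
qed

text \<open>
  Let \<open>\<phi>\<close> be a positive supersolution on the tree. The ratios \<open>X w f\<close> along the two directions of an
  edge multiply to \<open>a\<^sub>f\<^sup>2\<close>, and the inequality for \<open>\<phi>\<close> at the far end of the edge bounds the ratio in the
  backward direction by \<open>l - b\<close> minus the ratios that lead further away. The ratios depend on the
  vertex \<open>w\<close> of the tree; their infima over fibres of the covering depend only on \<open>f\<close> and
  satisfy the same inequality.
\<close>

lemma supersolution_of_top_form:
  assumes l: "C.top_form < l"
  shows "\<exists>S. (\<forall>f\<in>arcs G. 0 \<le> S f \<and> (a f)\<^sup>2 \<le> S f * (l - b (head G f) - (\<Sum>g\<in>beyond f. S g)))
    \<and> (\<forall>i\<in>verts G. 0 \<le> l - b i - (\<Sum>g\<in>out_arcs G i. S g))"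
proof -
  obtain \<phi> where \<phi>: "\<And>w. w \<in> W \<Longrightarrow> 0 < \<phi> w" "\<And>w. w \<in> W \<Longrightarrow>
      b (end_of w) * \<phi> w + (\<Sum>f\<in>out_arcs G (end_of w). \<bar>a f\<bar> * \<phi> (nbr w f)) \<le> l * \<phi> w"
    using positive_cover_supersolution[OF l] by blast
  define X where "X w f = \<bar>a f\<bar> * \<phi> (nbr w f) / \<phi> w" for w f
  define fibre where "fibre i = {w \<in> W. end_of w = i}" for i
  define S where "S f = Inf ((\<lambda>w. X w f) ` fibre (tail G f))" for f
  have fibre: "fibre i \<noteq> {}" if "i \<in> verts G" for i
    using cover_map_surj[OF that] by (auto simp: fibre_def)
  have X0: "0 \<le> X w f" if "w \<in> fibre (tail G f)" "f \<in> arcs G" for w f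
    using that \<phi>(1)[of w] \<phi>(1)[of "nbr w f"] nbr_in_W[of w f] unfolding X_def fibre_def
    by (intro divide_nonneg_pos mult_nonneg_nonneg) (auto intro: less_imp_le)
  have bdd: "bdd_below ((\<lambda>w. X w f) ` fibre (tail G f))" if "f \<in> arcs G" for f
    using X0 that by (intro bdd_belowI2[of _ 0]) auto
  have S_le: "S f \<le> X w f" if "f \<in> arcs G" "w \<in> fibre (tail G f)" for w f
    unfolding S_def using that bdd by (intro cINF_lower) auto
  have S_greatest: "c \<le> S f" if "f \<in> arcs G" "\<And>w. w \<in> fibre (tail G f) \<Longrightarrow> c \<le> X w f" for c f
    unfolding S_def using that fibre by (intro cINF_greatest) auto
  have X_sum: "(\<Sum>f\<in>out_arcs G (end_of w). X w f) \<le> l - b (end_of w)" if "w \<in> W" for w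
    using \<phi>[OF that] by (simp add: X_def flip: sum_divide_distrib) (simp add: field_simps)
  have S_super: "(a f)\<^sup>2 \<le> S f * (l - b (head G f) - (\<Sum>g\<in>beyond f. S g))" if f: "f \<in> arcs G" for f
  proof -
    let ?D = "l - b (head G f) - (\<Sum>g\<in>beyond f. S g)"
    have *: "(a f)\<^sup>2 \<le> X w f * ?D \<and> 0 \<le> ?D" if w: "w \<in> fibre (tail G f)" for w
    proof -
      define w' where "w' = nbr w f"
      have wW: "w \<in> W" "f \<in> out_arcs G (end_of w)" using w f by (auto simp: fibre_def)
      have w': "w' \<in> W" "end_of w' = head G f" "nbr w' (arev f) = w"
        using nbr_in_W[OF wW] nbr_arev[OF wW] by (auto simp: w'_def)
      have "(\<Sum>g\<in>beyond f. S g) \<le> (\<Sum>g\<in>beyond f. X w' g)"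
        using w' by (intro sum_mono S_le) (auto simp: beyond_def fibre_def)
      then have D: "X w' (arev f) \<le> ?D"
        using X_sum[OF w'(1)] sum_out_split_arev[OF f, of "X w'"] w'(2) by simp
      have "X w f * X w' (arev f) = (a f)\<^sup>2"
        using \<phi>(1)[OF wW(1)] \<phi>(1)[OF w'(1)] f
        by (simp add: X_def w'(3) weight_arev power2_eq_square flip: w'_def)
      moreover have "0 \<le> X w' (arev f)"
        using X0[of w' "arev f"] w' f by (simp add: fibre_def)
      ultimately show ?thesis
        using mult_left_mono[OF D X0[OF w f]] D by linarith
    qed
    obtain w where "w \<in> fibre (tail G f)" using fibre[of "tail G f"] f by auto
    then have D0: "0 \<le> ?D" using * by blast
    show ?thesis
    proof (cases "?D = 0")
      case True
      then show ?thesis using *[OF \<open>w \<in> fibre (tail G f)\<close>] by simp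
    next
      case False
      then have D: "0 < ?D" using D0 by simp
      have "(a f)\<^sup>2 / ?D \<le> S f" using * D by (intro S_greatest[OF f]) (simp add: pos_divide_le_eq)
      then show ?thesis using D by (simp add: pos_divide_le_eq)
    qed
  qed
  have S_vertex: "0 \<le> l - b i - (\<Sum>g\<in>out_arcs G i. S g)" if i: "i \<in> verts G" for i
  proof -
    obtain w where w: "w \<in> W" "end_of w = i" using cover_map_surj[OF i] by blast
    have "(\<Sum>g\<in>out_arcs G i. S g) \<le> (\<Sum>g\<in>out_arcs G i. X w g)"
      using w by (intro sum_mono S_le) (auto simp: fibre_def)
    then show ?thesis using X_sum[OF w(1)] w(2) by simp
  qed
  have "0 \<le> S f" if "f \<in> arcs G" for f using X0 that by (intro S_greatest) auto
  then show ?thesis using S_super S_vertex by blast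
qed

lemma equalising_tuple_exists:
  assumes "C.top_form < l"
  shows "\<exists>y. \<forall>i\<in>verts G. 0 < y i \<and> edge_expr G a b y i = l"
proof -
  \<comment> \<open>A supersolution at a smaller value \<open>m\<close> is strict at \<open>l\<close>, so all denominators are positive.\<close>
  define m where "m = (C.top_form + l) / 2"
  have m: "C.top_form < m" "m < l" using assms by (auto simp: m_def)
  obtain S where S: "\<And>f. f \<in> arcs G \<Longrightarrow> 0 \<le> S f"
      "\<And>f. f \<in> arcs G \<Longrightarrow> (a f)\<^sup>2 \<le> S f * (m - b (head G f) - (\<Sum>g\<in>beyond f. S g))"
      "\<And>i. i \<in> verts G \<Longrightarrow> 0 \<le> m - b i - (\<Sum>g\<in>out_arcs G i. S g)"
    using supersolution_of_top_form[OF m(1)] by blast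
  have "\<exists>t. \<forall>f\<in>arcs G. 0 \<le> t f \<and> t f \<le> S f \<and>
    t f * (l - b (head G f) - (\<Sum>g\<in>beyond f. t g)) = (a f)\<^sup>2"
  proof (rule beyond_fixed_point)
    fix f assume f: "f \<in> arcs G"
    show "0 \<le> S f" by (rule S(1)[OF f])
    have "S f * (m - b (head G f) - (\<Sum>g\<in>beyond f. S g)) \<le> S f * (l - b (head G f) - (\<Sum>g\<in>beyond f. S g))"
      using m(2) S(1)[OF f] by (intro mult_left_mono) auto
    with S(2)[OF f] show "(a f)\<^sup>2 \<le> S f * (l - b (head G f) - (\<Sum>g\<in>beyond f. S g))" by linarith
    have "0 \<le> m - b (head G f) - (\<Sum>g\<in>out_arcs G (head G f). S g)" using S(3) f by simp
    then show "0 < l - b (head G f) - (\<Sum>g\<in>beyond f. S g)"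
      using sum_out_split_arev[OF f, of S] S(1)[of "arev f"] f m(2) by simp
  qed
  then obtain t where t: "\<And>f. f \<in> arcs G \<Longrightarrow> 0 \<le> t f" "\<And>f. f \<in> arcs G \<Longrightarrow> t f \<le> S f"
    "\<And>f. f \<in> arcs G \<Longrightarrow> t f * (l - b (head G f) - (\<Sum>g\<in>beyond f. t g)) = (a f)\<^sup>2" by blast
  have pos: "0 < l - b i - (\<Sum>g\<in>out_arcs G i. t g)" if "i \<in> verts G" for i
  proof -
    have "(\<Sum>g\<in>out_arcs G i. t g) \<le> (\<Sum>g\<in>out_arcs G i. S g)" by (intro sum_mono t(2)) auto
    then show ?thesis using S(3)[OF that] m(2) by linarith
  qed
  define y where "y i = 1 / (l - b i - (\<Sum>g\<in>out_arcs G i. t g))" for i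
  have "0 < y i \<and> edge_expr G a b y i = l" if "i \<in> verts G" for i
    unfolding y_def by (intro conjI edge_expr_of_fixed_point t(1,3) pos that)
  then show ?thesis by (intro exI[of _ y]) simp
qed

end

lemma Inf_ereal_eqI:
  fixes r :: real
  assumes lower: "\<And>y. y \<in> Y \<Longrightarrow> r \<le> f y" and approx: "\<And>l. r < l \<Longrightarrow> \<exists>y\<in>Y. f y \<le> l"
  shows "ereal r = (INF y\<in>Y. ereal (f y))"
proof (rule antisym)
  show "ereal r \<le> (INF y\<in>Y. ereal (f y))" by (intro INF_greatest) (simp add: lower)
  show "(INF y\<in>Y. ereal (f y)) \<le> ereal r"
  proof (rule ereal_le_epsilon2)
    fix e :: real assume "0 < e"
    then obtain y where "y \<in> Y" "f y \<le> r + e" using approx[of "r + e"] by auto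
    then show "(INF y\<in>Y. ereal (f y)) \<le> ereal r + ereal e"
      by (intro INF_lower2[of y]) auto
  qed
qed

theorem theorem1p1:
  fixes G :: "(nat, 'e) pre_digraph" and arev :: "'e \<Rightarrow> 'e"
    and a :: "'e \<Rightarrow> real" and b :: "nat \<Rightarrow> real" and n v0 :: nat
  assumes "fin_digraph G" and "bidirected_digraph G arev"
    and "Digraph_Component.connected G"
    and "verts G = {1..n}"
    and "\<And>f. f \<in> arcs G \<Longrightarrow> a (arev f) = a f"
    and "v0 \<in> verts G"
  shows "\<exists>\<rho>. is_right_edge
            (spectrum (verts (universal_cover G arev v0)) (cover_jacobi_matrix G arev v0 a b)) \<rho>
      \<and> ereal \<rho> = (INF y\<in>{y :: nat \<Rightarrow> real. \<forall>i\<in>{1..n}. 0 < y i}.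
                      ereal (MAX i\<in>{1..n}. edge_expr G a b y i))
      \<and> ereal \<rho> = (INF y\<in>{y :: nat \<Rightarrow> real. (\<forall>i\<in>{1..n}. 0 < y i) \<and>
                          (\<forall>i\<in>{1..n}. \<forall>j\<in>{1..n}. edge_expr G a b y i = edge_expr G a b y j)}.
                      ereal (MAX i\<in>{1..n}. edge_expr G a b y i))"
proof -
  interpret weighted_graph G arev a b v0
    using assms by (intro weighted_graph.intro weighted_graph_axioms.intro)
  have ne: "{1..n} \<noteq> {}" using assms(4) base_in_verts by auto
  have lower: "C.top_form \<le> (MAX i\<in>{1..n}. edge_expr G a b y i)" if "\<forall>i\<in>{1..n}. 0 < y i" for y
    using that by (intro top_form_le_edge_expr[of y]) (auto simp: assms(4))
  have approx: "\<exists>y. (\<forall>i\<in>{1..n}. 0 < y i) \<and>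
      (\<forall>i\<in>{1..n}. \<forall>j\<in>{1..n}. edge_expr G a b y i = edge_expr G a b y j) \<and>
      (MAX i\<in>{1..n}. edge_expr G a b y i) \<le> l" if l: "C.top_form < l" for l
  proof -
    obtain y where y: "\<forall>i\<in>{1..n}. 0 < y i \<and> edge_expr G a b y i = l"
      using equalising_tuple_exists[OF l] assms(4) by auto
    then show ?thesis using ne by (intro exI[of _ y]) auto
  qed
  show ?thesis
  proof (intro exI[of _ C.top_form] conjI Inf_ereal_eqI)
    show "is_right_edge (spectrum (verts T) (cover_jacobi_matrix G arev v0 a b)) C.top_form"
      using C.right_edge by (simp add: cover_jacobi_matrix_def)
  qed (use lower approx in blast)+
qed

end
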